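(* Let $\sigma\ge\tau\ge1$, $\sigma>1$, let $\mathcal F=\{f_k\}_{k\in[K]}$ where each $f_k$ is a strongly $(\tau,\sigma)$-elastic cost function, and let $\hat f$ be the safe envelope of $\mathcal F$. Then for every $\alpha\ge\alpha_\star^{(\sigma)}:=\sigma^{\sigma/(\sigma-1)}$, the $\alpha$-design space $\mathcal S(\alpha,\hat f)$ is an $\alpha$-universal design space for $\mathcal F$: for every $f\in\mathcal F$, the planar region $\mathcal S(\alpha,\hat f)$ is contained in the planar region $\mathcal S(\alpha,f)$, and every reserve function $\phi$ in $\mathcal S(\alpha,\hat f)$ is $\alpha$-competitive for the cost $f$ (PUMax-$\phi$, run with cost $f$, is $\alpha$-competitive for OACC with cost $f$).
   Context: OACC. There are $m\ge 1$ supply nodes with cost function $f$. An instance $I$ is a finite sequence $(\mathbf v_t,\mathbf w_t)_{t=1}^T$, $v_{t,j}\ge0$, $w_{t,j}>0$. When demand $t$ arrives, an irrevocable $\mathbf x_t\in\mathcal X=\{\mathbf x\in\mathbb{R}_+^m:\sum_jx_j\le1\}$ is chosen. The objective is $\sum_t\sum_jv_{t,j}x_{t,j}-\sum_jf(\sum_tw_{t,j}x_{t,j})$; an online algorithm is $\alpha$-competitive if $\mathrm{OPT}(I)\le\alpha\,\mathrm{ALG}(I)$ for all $I$, with $\mathrm{OPT}$ the offline maximum. PUMax-$\phi$: start with $y_{0,j}=0$; upon arrival of $t$ choose $\mathbf x_t\in\arg\max_{\mathbf x\in\mathcal X}\sum_jv_{t,j}x_j-\sum_j\int_{y_{t-1,j}}^{y_{t-1,j}+w_{t,j}x_j}f'(\phi(\eta))\,d\eta$,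 and set $y_{t,j}=y_{t-1,j}+w_{t,j}x_{t,j}$. Elasticity: $Eg(y)=yg'(y)/g(y)$. Each cost $f_k:\mathbb{R}_+\to\mathbb{R}_+$ is increasing, smooth, strictly convex, analytic at the origin, with $f_k(0)=f_k'(0)=0$, $Ef_k'$ non-decreasing; strongly $(\tau,\sigma)$-elastic means in addition $\tau-2\le Ef_k''(y)\le\sigma-2$ for all $y>0$ (which implies $\tau-1\le Ef_k'\le\sigma-1$). Design space: $\mathcal S(\alpha,g)$ is the family of all continuous $\phi:[0,\infty)\to[0,\infty)$, differentiable on $(0,\infty)$, with $\phi'(y)=\alpha\frac{g'(\phi(y))-g'(y)}{\phi(y)g''(\phi(y))}$, $\phi'(y)\ge0$, $\phi(y)\ge y$ for $y>0$ and $\phi(0)=0$; the same symbol denotes the planar region $\bigcup_\phi\{(y,\phi(y)):y\ge0\}$. Safe envelope: let $k^*(y)=\arg\max_{k\in[K]}Ef_k''(y)$ (smallest index), taken to be piecewise constant with discrete switching points $y_1<y_2<\cdots$, $y_0=0$, and value $k_s$ on $(y_s,y_{s+1})$. Then $\hat f$ is the unique twice continuously differentiable function which on each interval $(y_s,y_{s+1})$ has the form $C_sf_{k_s}+L_s$ with $C_s>0$ constant and $L_s$ affine, with $C_0=1$, $L_0=0$ on $[0,y_1]$. *)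

theory Defs
  imports "HOL-Analysis.Analysis"
begin

section \<open>Functions on the half-line\<close>

text \<open>Functions on $[0,\infty)$ are represented by functions \<open>real \<Rightarrow> real\<close> whose values at negative
  arguments are irrelevant. Accordingly derivatives are taken within \<open>{0..}\<close>: two-sided at
  positive points, one-sided at the origin.\<close>

definition hderiv :: "(real \<Rightarrow> real) \<Rightarrow> real \<Rightarrow> real" where
  "hderiv g y = vector_derivative g (at y within {0..})"

definition elasticity :: "(real \<Rightarrow> real) \<Rightarrow> real \<Rightarrow> real" where
  "elasticity g y = y * hderiv g y / g y"

definition smooth_hl :: "(real \<Rightarrow> real) \<Rightarrow> bool" where
  "smooth_hl g \<longleftrightarrow> (\<forall>n. (hderiv ^^ n) g differentiable_on {0..})"

definition twice_cont_diff_hl :: "(real \<Rightarrow> real) \<Rightarrow> bool" where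
  "twice_cont_diff_hl g \<longleftrightarrow>
     g differentiable_on {0..} \<and> hderiv g differentiable_on {0..} \<and>
     continuous_on {0..} (hderiv (hderiv g))"

definition analytic_at_origin :: "(real \<Rightarrow> real) \<Rightarrow> bool" where
  "analytic_at_origin g \<longleftrightarrow> (\<exists>a. \<exists>r>0. \<forall>y\<in>{0..<r}. (\<lambda>n. a n * y ^ n) sums g y)"

definition strictly_convex_on :: "real set \<Rightarrow> (real \<Rightarrow> real) \<Rightarrow> bool" where
  "strictly_convex_on S g \<longleftrightarrow>
     (\<forall>x\<in>S. \<forall>y\<in>S. x \<noteq> y \<longrightarrow>
        (\<forall>u. 0 < u \<and> u < 1 \<longrightarrow> g ((1 - u) * x + u * y) < (1 - u) * g x + u * g y))"


section \<open>Cost functions\<close>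

definition cost_function :: "(real \<Rightarrow> real) \<Rightarrow> bool" where
  "cost_function f \<longleftrightarrow>
     (\<forall>y\<ge>0. f y \<ge> 0) \<and> mono_on {0..} f \<and> smooth_hl f \<and>
     strictly_convex_on {0..} f \<and> analytic_at_origin f \<and>
     f 0 = 0 \<and> hderiv f 0 = 0 \<and>
     mono_on {0<..} (elasticity (hderiv f))"

definition strongly_elastic :: "real \<Rightarrow> real \<Rightarrow> (real \<Rightarrow> real) \<Rightarrow> bool" where
  "strongly_elastic \<tau> \<sigma> f \<longleftrightarrow>
     cost_function f \<and>
     (\<forall>y>0. \<tau> - 2 \<le> elasticity (hderiv (hderiv f)) y \<and>
            elasticity (hderiv (hderiv f)) y \<le> \<sigma> - 2)"


section \<open>Online allocation with convex costs\<close>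

text \<open>A demand is a pair \<open>(v, w)\<close>; only the components \<open>j < m\<close> of \<open>v\<close>, \<open>w\<close> and of a decision \<open>x\<close>
  are relevant. Demands and time steps are numbered from \<open>0\<close>.\<close>

type_synonym demand = "(nat \<Rightarrow> real) \<times> (nat \<Rightarrow> real)"
type_synonym decision = "nat \<Rightarrow> real"

definition valid_instance :: "nat \<Rightarrow> demand list \<Rightarrow> bool" where
  "valid_instance m I \<longleftrightarrow> (\<forall>(v, w)\<in>set I. \<forall>j<m. v j \<ge> 0 \<and> w j > 0)"

definition feasible :: "nat \<Rightarrow> decision set" where
  "feasible m = {x. (\<forall>j<m. x j \<ge> 0) \<and> (\<Sum>j<m. x j) \<le> 1}"

definition objective ::
    "nat \<Rightarrow> (real \<Rightarrow> real) \<Rightarrow> demand list \<Rightarrow> (nat \<Rightarrow> decision) \<Rightarrow> real" where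
  "objective m f I x =
     (\<Sum>t<length I. \<Sum>j<m. fst (I ! t) j * x t j) -
     (\<Sum>j<m. f (\<Sum>t<length I. snd (I ! t) j * x t j))"

definition OPT :: "nat \<Rightarrow> (real \<Rightarrow> real) \<Rightarrow> demand list \<Rightarrow> real" where
  "OPT m f I = (SUP x \<in> {x. \<forall>t<length I. x t \<in> feasible m}. objective m f I x)"

text \<open>An online algorithm maps the demands seen so far, the newest one last, to the decision for
  the newest demand.\<close>

type_synonym algorithm = "demand list \<Rightarrow> decision"

definition decisions :: "algorithm \<Rightarrow> demand list \<Rightarrow> nat \<Rightarrow> decision" where
  "decisions A I t = A (take (Suc t) I)"

definition ALG :: "nat \<Rightarrow> (real \<Rightarrow> real) \<Rightarrow> algorithm \<Rightarrow> demand list \<Rightarrow> real" where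
  "ALG m f A I = objective m f I (decisions A I)"

definition online_algorithm :: "nat \<Rightarrow> algorithm \<Rightarrow> bool" where
  "online_algorithm m A \<longleftrightarrow> (\<forall>I. valid_instance m I \<and> I \<noteq> [] \<longrightarrow> A I \<in> feasible m)"

definition competitive :: "nat \<Rightarrow> (real \<Rightarrow> real) \<Rightarrow> real \<Rightarrow> algorithm \<Rightarrow> bool" where
  "competitive m f \<alpha> A \<longleftrightarrow>
     online_algorithm m A \<and> (\<forall>I. valid_instance m I \<longrightarrow> OPT m f I \<le> \<alpha> * ALG m f A I)"


section \<open>PUMax with a reserve function\<close>

definition utilization :: "algorithm \<Rightarrow> demand list \<Rightarrow> nat \<Rightarrow> real" where
  "utilization A I j = (\<Sum>t<length I. snd (I ! t) j * decisions A I t j)"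

definition pseudo_utility ::
    "nat \<Rightarrow> (real \<Rightarrow> real) \<Rightarrow> (real \<Rightarrow> real) \<Rightarrow> (nat \<Rightarrow> real) \<Rightarrow> demand \<Rightarrow> decision \<Rightarrow> real" where
  "pseudo_utility m f \<phi> y d x =
     (\<Sum>j<m. fst d j * x j) -
     (\<Sum>j<m. integral {y j .. y j + snd d j * x j} (\<lambda>\<eta>. hderiv f (\<phi> \<eta>)))"

text \<open>Ties in the maximization are broken arbitrarily, possibly depending on the whole history.\<close>

definition PUMax :: "nat \<Rightarrow> (real \<Rightarrow> real) \<Rightarrow> (real \<Rightarrow> real) \<Rightarrow> algorithm \<Rightarrow> bool" where
  "PUMax m f \<phi> A \<longleftrightarrow>
     (\<forall>I d. valid_instance m (I @ [d]) \<longrightarrow>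
        is_arg_max (pseudo_utility m f \<phi> (utilization A I) d) (\<lambda>x. x \<in> feasible m) (A (I @ [d])))"

text \<open>The first conjunct says that PUMax is well defined, i.e. that the maxima are attained; the
  second would be vacuous otherwise.\<close>

definition reserve_competitive ::
    "nat \<Rightarrow> (real \<Rightarrow> real) \<Rightarrow> real \<Rightarrow> (real \<Rightarrow> real) \<Rightarrow> bool" where
  "reserve_competitive m f \<alpha> \<phi> \<longleftrightarrow>
     (\<exists>A. PUMax m f \<phi> A) \<and> (\<forall>A. PUMax m f \<phi> A \<longrightarrow> competitive m f \<alpha> A)"


section \<open>Design spaces\<close>

definition design_space :: "real \<Rightarrow> (real \<Rightarrow> real) \<Rightarrow> (real \<Rightarrow> real) set" where
  "design_space \<alpha> g =
     {\<phi>. (\<forall>y\<ge>0. \<phi> y \<ge> 0) \<and> continuous_on {0..} \<phi> \<and> \<phi> 0 = 0 \<and>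
         (\<forall>y>0. \<phi> differentiable (at y) \<and>
                deriv \<phi> y =
                  \<alpha> * ((hderiv g (\<phi> y) - hderiv g y) / (\<phi> y * hderiv (hderiv g) (\<phi> y))) \<and>
                deriv \<phi> y \<ge> 0 \<and> \<phi> y \<ge> y)}"

definition planar_region :: "(real \<Rightarrow> real) set \<Rightarrow> (real \<times> real) set" where
  "planar_region \<Phi> = (\<Union>\<phi>\<in>\<Phi>. {(y, \<phi> y) | y. y \<ge> 0})"

definition universal_design_space ::
    "nat \<Rightarrow> real \<Rightarrow> (real \<Rightarrow> real) set \<Rightarrow> (real \<Rightarrow> real) set \<Rightarrow> bool" where
  "universal_design_space m \<alpha> \<Phi> F \<longleftrightarrow>
     (\<forall>f\<in>F. planar_region \<Phi> \<subseteq> planar_region (design_space \<alpha> f) \<and>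
            (\<forall>\<phi>\<in>\<Phi>. reserve_competitive m f \<alpha> \<phi>))"


section \<open>The safe envelope\<close>

definition kstar :: "nat \<Rightarrow> (nat \<Rightarrow> real \<Rightarrow> real) \<Rightarrow> real \<Rightarrow> nat" where
  "kstar K f y =
     (LEAST k. is_arg_max (\<lambda>k. elasticity (hderiv (hderiv (f k))) y) (\<lambda>k. k \<in> {1..K}) k)"

text \<open>The switching points form a set \<open>Y\<close>, finite or infinite, which is locally finite in
  $[0,\infty)$. The open interval from \<open>s \<in> insert 0 Y\<close> to its successor in \<open>Y\<close> (unbounded if there is
  none) is \<open>piece Y s\<close>; data attached to an interval are indexed by its left endpoint.\<close>

definition piece :: "real set \<Rightarrow> real \<Rightarrow> real set" where
  "piece Y s = {y. s < y \<and> (\<forall>z\<in>Y. s < z \<longrightarrow> y < z)}"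

definition switching_points ::
    "nat \<Rightarrow> (nat \<Rightarrow> real \<Rightarrow> real) \<Rightarrow> real set \<Rightarrow> (real \<Rightarrow> nat) \<Rightarrow> bool" where
  "switching_points K f Y \<kappa> \<longleftrightarrow>
     Y \<subseteq> {0<..} \<and> (\<forall>b. finite (Y \<inter> {..b})) \<and>
     (\<forall>s\<in>insert 0 Y. \<forall>y\<in>piece Y s. kstar K f y = \<kappa> s)"

text \<open>The affine function \<open>L\<close> on the piece starting at \<open>s\<close> is \<open>\<lambda>y. p s + q s * y\<close>. By continuity, the
  formula on a piece extends to its endpoints.\<close>

definition safe_envelope ::
    "nat \<Rightarrow> (nat \<Rightarrow> real \<Rightarrow> real) \<Rightarrow> (real \<Rightarrow> real) \<Rightarrow> bool" where
  "safe_envelope K f h \<longleftrightarrow>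
     twice_cont_diff_hl h \<and>
     (\<exists>Y \<kappa> C p q. switching_points K f Y \<kappa> \<and>
        C 0 = 1 \<and> p 0 = 0 \<and> q 0 = 0 \<and>
        (\<forall>s\<in>insert 0 Y. C s > 0 \<and>
           (\<forall>y\<in>piece Y s. h y = C s * f (\<kappa> s) y + (p s + q s * y))))"

end

theory Submission
  imports Defs
begin

text \<open>The safe envelope \<open>h\<close> dominates the elasticity of every \<open>f''\<close>, so \<open>h'' / f''\<close> is
  nondecreasing and \<open>(h' z - h' y) / h'' z \<le> (f' z - f' y) / f'' z\<close> for \<open>y \<le> z\<close>. A reserve
  function \<open>\<phi>\<close> of the envelope therefore satisfies, for each cost \<open>f\<close>, the differential equation of
  the design space as an inequality \<open>\<phi>' \<le> \<dots>\<close>.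

  Competitiveness needs only this inequality: it is the derivative of
  \<open>f\<^sup>* (f' (\<phi> y)) \<le> \<alpha> * (\<integral>\<^sub>0\<^sup>y f' (\<phi>) - f y)\<close>, which feeds a primal-dual argument with the
  final marginal prices \<open>f' (\<phi> y)\<close> as dual variables.

  For the planar regions, solve the equation of \<open>f\<close> through a point \<open>(y0, \<phi> y0)\<close>. Forward, \<open>\<phi>\<close> is a
  subsolution and keeps the solution \<open>\<psi>\<close> above the diagonal. Backward, \<open>\<psi> \<le> \<phi>\<close> forces
  \<open>\<psi> \<rightarrow> 0\<close> at the origin, and \<open>\<psi>\<close> cannot meet the diagonal, on which the slope is \<open>0\<close>.\<close>

section \<open>Picard iteration\<close>

text \<open>Measured against the weight exp (2 L |t|), integration of a derivative of size
  \<open>L * M\<close> gains a factor 1/2. This is the contraction step of the iteration, on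
  intervals of any length.\<close>

lemma growth_bound:
  fixes w w' :: "real \<Rightarrow> real"
  assumes w: "\<And>t. (w has_real_derivative w' t) (at t)" and "w 0 = 0" and "L > 0"
    and bound: "\<And>t. \<bar>t\<bar> \<le> b \<Longrightarrow> \<bar>w' t\<bar> \<le> L * (M * exp (2 * L * \<bar>t\<bar>))"
    and "\<bar>t\<bar> \<le> b" and "M \<ge> 0"
  shows "\<bar>w t\<bar> \<le> M / 2 * exp (2 * L * \<bar>t\<bar>)"
proof -
  have forward: "v t \<le> M / 2 * exp (2 * L * t)"
    if v: "\<And>t. (v has_real_derivative v' t) (at t)" and "v 0 = 0" and "0 \<le> t"
      and v': "\<And>s. 0 \<le> s \<Longrightarrow> s \<le> t \<Longrightarrow> v' s \<le> L * (M * exp (2 * L * s))"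
    for v v' :: "real \<Rightarrow> real" and t :: real
  proof -
    have "v t - M / 2 * exp (2 * L * t) \<le> v 0 - M / 2 * exp (2 * L * 0)"
    proof (rule DERIV_nonpos_imp_nonincreasing[OF \<open>0 \<le> t\<close>])
      fix s assume s: "0 \<le> s" "s \<le> t"
      have "((\<lambda>s. v s - M / 2 * exp (2 * L * s)) has_real_derivative
               v' s - L * (M * exp (2 * L * s))) (at s)"
        using v by (auto intro!: derivative_eq_intros)
      then show "\<exists>y. ((\<lambda>s. v s - M / 2 * exp (2 * L * s)) has_real_derivative y) (at s) \<and> y \<le> 0"
        using v'[OF s] by (intro exI[of _ "v' s - L * (M * exp (2 * L * s))"]) simp
    qed
    then show ?thesis using \<open>v 0 = 0\<close> \<open>M \<ge> 0\<close> by simp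
  qed
  \<comment> \<open>Changing the sign of \<open>w\<close> and reflecting \<open>t\<close> turn lower
    bounds and negative times into instances of \<open>forward\<close>.\<close>
  have neg: "((\<lambda>t. - w t) has_real_derivative - w' t) (at t)"
    and flip: "((\<lambda>t. w (- t)) has_real_derivative - w' (- t)) (at t)"
    and negflip: "((\<lambda>t. - w (- t)) has_real_derivative w' (- t)) (at t)" for t
    using w[of t] w[of "- t"] DERIV_minus[of "\<lambda>t. w (- t)" "- w' (- t)" t UNIV]
    by (auto simp: DERIV_mirror intro: DERIV_minus)
  have bounds: "w' s \<le> L * (M * exp (2 * L * s))" "- w' s \<le> L * (M * exp (2 * L * s))"
    "w' (- s) \<le> L * (M * exp (2 * L * s))" "- w' (- s) \<le> L * (M * exp (2 * L * s))"
    if "0 \<le> s" "s \<le> \<bar>t\<bar>" for s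
    using bound[of s] bound[of "- s"] that \<open>\<bar>t\<bar> \<le> b\<close>
    by (simp_all only: abs_of_nonneg abs_minus_cancel) linarith+
  show ?thesis
  proof (cases "t \<ge> 0")
    case True
    have "w t \<le> M / 2 * exp (2 * L * t)"
      by (rule forward[OF w]) (use \<open>w 0 = 0\<close> True bounds in auto)
    moreover have "- w t \<le> M / 2 * exp (2 * L * t)"
      by (rule forward[OF neg]) (use \<open>w 0 = 0\<close> True bounds in auto)
    ultimately show ?thesis using True by simp
  next
    case False
    have "w (- (- t)) \<le> M / 2 * exp (2 * L * (- t))"
      by (rule forward[OF flip]) (use \<open>w 0 = 0\<close> False bounds in auto)
    moreover have "- w (- (- t)) \<le> M / 2 * exp (2 * L * (- t))"
      by (rule forward[OF negflip]) (use \<open>w 0 = 0\<close> False bounds in auto)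
    ultimately show ?thesis using False by simp
  qed
qed

lemma antiderivative_through:
  fixes g :: "real \<Rightarrow> real"
  assumes "continuous_on UNIV g"
  shows "\<exists>P. P 0 = c \<and> (\<forall>t. (P has_real_derivative g t) (at t))"
proof -
  obtain P where P: "\<And>t. (P has_vector_derivative g t) (at t)"
    using einterval_antiderivative[of "-\<infinity>" \<infinity> g] assms
    by (auto simp: continuous_on_eq_continuous_at)
  have "((\<lambda>t. P t - P 0 + c) has_real_derivative g t) (at t)" for t
    using P[of t] by (auto intro!: derivative_eq_intros simp: has_real_derivative_iff_has_vector_derivative)
  then show ?thesis by (intro exI[of _ "\<lambda>t. P t - P 0 + c"]) auto
qed

text \<open>The Lipschitz constant is uniform in \<open>t\<close>, so the Picard iterates converge
  locally uniformly on the whole line and the solution is global.\<close>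

lemma picard_lindelof_global:
  fixes F :: "real \<Rightarrow> real \<Rightarrow> real"
  assumes cont: "continuous_on UNIV (\<lambda>(t, x). F t x)"
    and lip: "\<And>t x y. \<bar>F t x - F t y\<bar> \<le> L * \<bar>x - y\<bar>" and "L > 0"
  shows "\<exists>u. u 0 = c \<and> (\<forall>t. (u has_real_derivative F t (u t)) (at t))"
proof -
  have contF: "continuous_on UNIV (\<lambda>t. F t (u t))" if "continuous_on UNIV u" for u :: "real \<Rightarrow> real"
  proof -
    have "continuous_on UNIV (\<lambda>t. (t, u t))" by (intro continuous_intros that)
    from continuous_on_compose2[OF cont this] show ?thesis by simp
  qed
  define T where "T u = (SOME P. P 0 = c \<and> (\<forall>t. (P has_real_derivative F t (u t)) (at t)))" for u
  have T: "T u 0 = c" "(T u has_real_derivative F t (u t)) (at t)" if "continuous_on UNIV u" for u t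
    using someI_ex[OF antiderivative_through[OF contF[OF that], of c]] unfolding T_def by auto
  define U where "U n = (T ^^ n) (\<lambda>_. c)" for n
  have U_cont: "continuous_on UNIV (U n)" for n
  proof (induction n)
    case (Suc n)
    then show ?case using T(2)[OF Suc]
      by (auto simp: U_def intro!: continuous_at_imp_continuous_on DERIV_isCont)
  qed (simp add: U_def)
  have U0: "U n 0 = c" for n
    using T(1)[OF U_cont] by (cases n) (auto simp: U_def)
  have U': "(U (Suc n) has_real_derivative F t (U n t)) (at t)" for n t
    using T(2)[OF U_cont[of n], of t] by (simp add: U_def)
  define D where "D n t = U (Suc n) t - U n t" for n t
  have D': "(D (Suc n) has_real_derivative F t (U (Suc n) t) - F t (U n t)) (at t)" for n t
    unfolding D_def using U'[of "Suc n" t] U'[of n t] by (auto intro!: derivative_eq_intros)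
  have D_bound: "\<exists>M\<ge>0. \<forall>n t. \<bar>t\<bar> \<le> b \<longrightarrow> \<bar>D n t\<bar> \<le> M * (1/2)^n" for b
  proof -
    have "continuous_on {-b..b} (D 0)"
      unfolding D_def by (intro continuous_intros continuous_on_subset[OF U_cont]) auto
    then have "bounded (D 0 ` {-b..b})"
      by (intro compact_imp_bounded compact_continuous_image) auto
    then obtain M where M: "M > 0" "\<And>t. t \<in> {-b..b} \<Longrightarrow> \<bar>D 0 t\<bar> \<le> M"
      by (auto simp: bounded_pos)
    have *: "\<bar>D n t\<bar> \<le> M * (1/2)^n * exp (2 * L * \<bar>t\<bar>)" if "\<bar>t\<bar> \<le> b" for n t
      using that
    proof (induction n arbitrary: t)
      case 0
      have "\<bar>D 0 t\<bar> \<le> M" using M(2)[of t] 0 by (auto simp: abs_le_iff)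
      also have "\<dots> \<le> M * exp (2 * L * \<bar>t\<bar>)" using M \<open>L > 0\<close> by simp
      finally show ?case by simp
    next
      case (Suc n)
      have "\<bar>D (Suc n) t\<bar> \<le> M * (1/2)^n / 2 * exp (2 * L * \<bar>t\<bar>)"
      proof (rule growth_bound[OF D' _ \<open>L > 0\<close> _ Suc.prems])
        fix s assume "\<bar>s\<bar> \<le> b"
        have "\<bar>F s (U (Suc n) s) - F s (U n s)\<bar> \<le> L * \<bar>D n s\<bar>"
          using lip[of s "U (Suc n) s" "U n s"] by (simp add: D_def)
        also have "\<dots> \<le> L * (M * (1/2)^n * exp (2 * L * \<bar>s\<bar>))"
          using Suc.IH[OF \<open>\<bar>s\<bar> \<le> b\<close>] \<open>L > 0\<close> by simp
        finally show "\<bar>F s (U (Suc n) s) - F s (U n s)\<bar> \<le> L * (M * (1/2)^n * exp (2 * L * \<bar>s\<bar>))" .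
      qed (use M in \<open>auto simp: D_def U0\<close>)
      then show ?case by simp
    qed
    have "\<bar>D n t\<bar> \<le> M * exp (2 * L * b) * (1/2)^n" if "\<bar>t\<bar> \<le> b" for n t
    proof -
      have "M * (1/2)^n * exp (2 * L * \<bar>t\<bar>) \<le> M * (1/2)^n * exp (2 * L * b)"
        using that M \<open>L > 0\<close> by (intro mult_left_mono) auto
      then show ?thesis using *[OF that, of n] by (simp add: mult_ac)
    qed
    then show ?thesis using M by (intro exI[of _ "M * exp (2 * L * b)"]) auto
  qed
  \<comment> \<open>The first iterate is split off: only from \<open>D 1\<close> on do the
    differences have derivatives of the form \<open>F t (U (Suc n) t) - F t (U n t)\<close>, which
    telescope.\<close>
  define u where "u t = U 1 t + (\<Sum>n. D (Suc n) t)" for t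
  have sumD: "summable (\<lambda>n. D (Suc n) t)" for t
  proof -
    obtain M where "\<And>n. \<bar>D n t\<bar> \<le> M * (1/2)^n" using D_bound[of "\<bar>t\<bar>"] by auto
    then have le: "norm (D (Suc n) t) \<le> M * (1/2)^(Suc n)" for n
      by (metis real_norm_def)
    have "summable (\<lambda>n. M * (1/2)^(Suc n) :: real)"
      by (intro summable_mult summable_ignore_initial_segment[where k = 1, simplified]) (auto intro: summable_geometric)
    from summable_comparison_test'[OF this le] show ?thesis .
  qed
  have Uu: "(\<lambda>n. U n t) \<longlonglongrightarrow> u t" for t
  proof -
    have "(\<lambda>n. U 1 t + (\<Sum>i<n. D (Suc i) t)) \<longlonglongrightarrow> u t"
      unfolding u_def using sumD[of t] by (intro tendsto_intros summable_LIMSEQ)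
    moreover have "U 1 t + (\<Sum>i<n. D (Suc i) t) = U (Suc n) t" for n
      by (induction n) (auto simp: D_def)
    ultimately show ?thesis by (intro LIMSEQ_imp_Suc[of "\<lambda>n. U n t"]) simp
  qed
  have "(u has_real_derivative F t (u t)) (at t)" for t
  proof -
    define b where "b = \<bar>t\<bar> + 1"
    obtain M where M: "M \<ge> 0" "\<And>n t. \<bar>t\<bar> \<le> b \<Longrightarrow> \<bar>D n t\<bar> \<le> M * (1/2)^n" using D_bound[of b] by auto
    \<comment> \<open>The Lipschitz condition passes the geometric decay on to the differentiated
      series, which justifies termwise differentiation.\<close>
    have uconv: "uniformly_convergent_on {-b..b} (\<lambda>n s. \<Sum>i<n. F s (U (Suc i) s) - F s (U i s))"
    proof (rule Weierstrass_m_test')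
      fix n s assume "s \<in> {-b..b}"
      then have "\<bar>D n s\<bar> \<le> M * (1/2)^n" using M by auto
      moreover have "\<bar>F s (U (Suc n) s) - F s (U n s)\<bar> \<le> L * \<bar>D n s\<bar>"
        using lip[of s "U (Suc n) s" "U n s"] by (simp add: D_def)
      ultimately show "norm (F s (U (Suc n) s) - F s (U n s)) \<le> L * (M * (1/2)^n)"
        using \<open>L > 0\<close> by (smt (verit) mult_left_mono real_norm_def)
    qed (intro summable_mult summable_geometric, simp)
    have "((\<lambda>t. \<Sum>n. D (Suc n) t) has_real_derivative (\<Sum>n. F t (U (Suc n) t) - F t (U n t))) (at t)"
      by (rule has_field_derivative_series'(2)[OF _ _ uconv _ sumD, of _ 0])
        (auto intro!: D' has_field_derivative_at_within simp: b_def)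
    moreover have "(\<lambda>n. F t (U (Suc n) t) - F t (U n t)) sums (F t (u t) - F t (U 0 t))"
    proof (rule telescope_sums)
      have "continuous_on UNIV (\<lambda>x :: real. (t, x))" by (intro continuous_intros)
      from continuous_on_compose2[OF cont this] have "isCont (F t) (u t)"
        by (simp add: continuous_on_eq_continuous_at)
      then show "(\<lambda>n. F t (U n t)) \<longlonglongrightarrow> F t (u t)"
        using Uu isCont_tendsto_compose by blast
    qed
    ultimately show ?thesis
      unfolding u_def using U'[of 0 t] by (auto intro!: derivative_eq_intros simp: sums_iff)
  qed
  moreover have "u 0 = c"
    using Uu[of 0] LIMSEQ_unique[of "\<lambda>_. c" c] by (simp add: U0 LIMSEQ_const_iff)
  ultimately show ?thesis by blast
qed

text \<open>The substitution y = y0 * exp t maps the line onto the half-line and turns the Lipschitz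
  constant L / y, singular at the origin, into the uniform constant \<open>L\<close>.\<close>

lemma ode_half_line:
  fixes R :: "real \<Rightarrow> real \<Rightarrow> real"
  assumes cont: "continuous_on ({0<..} \<times> UNIV) (\<lambda>(y, x). R y x)"
    and lip: "\<And>y x x'. y > 0 \<Longrightarrow> \<bar>R y x - R y x'\<bar> \<le> L / y * \<bar>x - x'\<bar>"
    and "L > 0" and "y0 > 0"
  shows "\<exists>u. u y0 = c \<and> (\<forall>y>0. (u has_real_derivative R y (u y)) (at y))"
proof -
  define F where "F t x = y0 * exp t * R (y0 * exp t) x" for t x
  have "continuous_on UNIV (\<lambda>p :: real \<times> real. (y0 * exp (fst p), snd p))"
    by (intro continuous_intros)
  from continuous_on_compose2[OF cont this]
  have "continuous_on UNIV (\<lambda>p. R (y0 * exp (fst p)) (snd p))"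
    using \<open>y0 > 0\<close> by (auto simp: image_subset_iff)
  then have "continuous_on UNIV (\<lambda>(t, x). F t x)"
    unfolding F_def case_prod_beta by (intro continuous_intros)
  moreover have "\<bar>F t x - F t y\<bar> \<le> L * \<bar>x - y\<bar>" for t x y
  proof -
    have "\<bar>F t x - F t y\<bar> = y0 * exp t * \<bar>R (y0 * exp t) x - R (y0 * exp t) y\<bar>"
      using \<open>y0 > 0\<close> by (simp add: F_def abs_mult flip: right_diff_distrib)
    also have "\<dots> \<le> y0 * exp t * (L / (y0 * exp t) * \<bar>x - y\<bar>)"
      using \<open>y0 > 0\<close> by (intro mult_left_mono lip) auto
    also have "\<dots> = L * \<bar>x - y\<bar>" using \<open>y0 > 0\<close> by simp
    finally show ?thesis .
  qed
  ultimately obtain v where v: "v 0 = c" "\<And>t. (v has_real_derivative F t (v t)) (at t)"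
    using picard_lindelof_global[of F L c] \<open>L > 0\<close> by auto
  have "((\<lambda>y. v (ln (y / y0))) has_real_derivative R y (v (ln (y / y0)))) (at y)" if "y > 0" for y
  proof -
    have "((\<lambda>y. ln (y / y0)) has_real_derivative 1 / y) (at y)"
      using that \<open>y0 > 0\<close> by (auto intro!: derivative_eq_intros)
    from DERIV_chain2[OF v(2) this] show ?thesis
      using that \<open>y0 > 0\<close> by (simp add: F_def)
  qed
  then show ?thesis using v(1) \<open>y0 > 0\<close> by (intro exI[of _ "\<lambda>y. v (ln (y / y0))"]) auto
qed

section \<open>Cost functions\<close>

lemma hderiv_eq:
  assumes "(g has_real_derivative d) (at y within {0..})" "y \<ge> 0"
  shows "hderiv g y = d"
proof -
  have "y islimpt {0..}"
  proof (rule connected_imp_perfect)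
    fix x :: real
    have "0 \<in> {0 :: real..}" "1 \<in> {0 :: real..}" by auto
    then show "{0..} \<noteq> {x}" by (metis singletonD zero_neq_one)
  qed (use assms in auto)
  then show ?thesis
    unfolding hderiv_def using assms(1)
    by (intro vector_derivative_within)
      (auto simp: trivial_limit_within has_real_derivative_iff_has_vector_derivative)
qed

lemma at_within_half_line: "y > 0 \<Longrightarrow> at y within {0..} = at (y :: real)"
  by (intro at_within_interior) auto

lemma hderiv_works:
  assumes "g differentiable_on {0..}" "y \<ge> 0"
  shows "(g has_real_derivative hderiv g y) (at y within {0..})"
  using assms unfolding hderiv_def differentiable_on_def
  by (auto simp: has_real_derivative_iff_has_vector_derivative vector_derivative_works)

lemma nondecreasing_half_line:
  fixes g :: "real \<Rightarrow> real"
  assumes "continuous_on {0..} g" and "\<And>y. y > 0 \<Longrightarrow> (g has_real_derivative g' y) (at y)"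
    and "\<And>y. y > 0 \<Longrightarrow> g' y \<ge> 0" and "0 \<le> a" "a \<le> b"
  shows "g a \<le> g b"
proof (rule DERIV_nonneg_imp_increasing_open[OF \<open>a \<le> b\<close>])
  show "continuous_on {a..b} g" using assms by (auto intro: continuous_on_subset)
  show "\<exists>d. (g has_real_derivative d) (at x) \<and> d \<ge> 0" if "a < x" "x < b" for x
    using assms that by (intro exI[of _ "g' x"]) auto
qed

section \<open>Convexity of a cost and positivity of its derivatives\<close>

locale cost =
  fixes f :: "real \<Rightarrow> real"
  assumes cost: "cost_function f"
begin

abbreviation "f' \<equiv> hderiv f"
abbreviation "f'' \<equiv> hderiv f'"
abbreviation "f''' \<equiv> hderiv f''"

lemma differentiable: "f differentiable_on {0..}" "f' differentiable_on {0..}" "f'' differentiable_on {0..}"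
proof -
  have *: "(hderiv ^^ n) f differentiable_on {0..}" for n
    using cost by (auto simp: cost_function_def smooth_hl_def)
  show "f differentiable_on {0..}" "f' differentiable_on {0..}" "f'' differentiable_on {0..}"
    using *[of 0] *[of 1] *[of 2] by (auto simp: numeral_2_eq_2)
qed

lemmas deriv_within = differentiable[THEN hderiv_works]

lemma deriv_at:
  assumes "y > 0"
  shows "(f has_real_derivative f' y) (at y)" "(f' has_real_derivative f'' y) (at y)"
    "(f'' has_real_derivative f''' y) (at y)"
  using deriv_within[of y] assms by (auto simp: at_within_half_line)

lemma continuous: "continuous_on {0..} f" "continuous_on {0..} f'" "continuous_on {0..} f''"
  using differentiable by (auto intro: differentiable_imp_continuous_on)

lemma at_zero [simp]: "f 0 = 0" "f' 0 = 0"
  using cost by (auto simp: cost_function_def)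

lemma nonneg: "y \<ge> 0 \<Longrightarrow> f y \<ge> 0"
  using cost by (auto simp: cost_function_def)

lemma strictly_convex:
  "0 \<le> x \<Longrightarrow> 0 \<le> y \<Longrightarrow> x \<noteq> y \<Longrightarrow> 0 < u \<Longrightarrow> u < 1 \<Longrightarrow>
     f ((1 - u) * x + u * y) < (1 - u) * f x + u * f y"
  using cost by (auto simp: cost_function_def strictly_convex_on_def)

lemma above_tangent:
  assumes "x \<ge> 0" "c \<ge> 0"
  shows "f x \<ge> f c + f' c * (x - c)"
\<comment> \<open>The origin is not interior to the half-line; the tangent there is the zero
  line.\<close>
proof (cases "c = 0")
  case True
  then show ?thesis using nonneg assms by simp
next
  case False
  have "convex_on {0..} f"
  proof (rule convex_onI)
    fix t x y :: real assume "0 < t" "t < 1" "x \<in> {0..}" "y \<in> {0..}"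
    then show "f ((1 - t) *\<^sub>R x + t *\<^sub>R y) \<le> (1 - t) * f x + t * f y"
      using strictly_convex[of x y t] by (cases "x = y") (auto simp: algebra_simps)
  qed simp
  from convex_on_imp_above_tangent[OF this _ _ _ deriv_within(1)[OF assms(2)], of x]
  show ?thesis using False assms by simp
qed

lemma deriv_mono:
  assumes "0 \<le> x" "x \<le> y"
  shows "f' x \<le> f' y"
proof (cases "x = y")
  case False
  have "(f' y - f' x) * (y - x) \<ge> 0"
    using above_tangent[of x y] above_tangent[of y x] assms by (simp add: algebra_simps)
  then show ?thesis using False assms by (simp add: zero_le_mult_iff)
qed simp

lemma deriv_nonneg: "y \<ge> 0 \<Longrightarrow> f' y \<ge> 0"
  using deriv_mono[of 0 y] by simp

text \<open>If \<open>f' y\<close> were 0, the tangent at \<open>y\<close> would give f y <= f 0 =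
  0, and strict convexity would make \<open>f\<close> negative at y / 2.\<close>

lemma deriv_pos:
  assumes "y > 0"
  shows "f' y > 0"
proof (rule ccontr)
  assume "\<not> f' y > 0"
  then have "f' y = 0" using deriv_nonneg[of y] assms by simp
  then have "f y \<le> 0" using above_tangent[of 0 y] assms by simp
  then show False
    using strictly_convex[of 0 y "1/2"] nonneg[of "y/2"] assms by simp
qed

lemma deriv2_nonneg: "y > 0 \<Longrightarrow> f'' y \<ge> 0"
  by (rule mono_on_imp_deriv_nonneg[where A = "{0..}", OF _ deriv_at(2)])
    (auto simp: mono_on_def deriv_mono)

lemma deriv_elasticity_mono:
  assumes "0 < x" "x \<le> y"
  shows "x * f'' x / f' x \<le> y * f'' y / f' y"
  using cost assms by (auto simp: cost_function_def mono_on_def elasticity_def)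

text \<open>A zero of \<open>f''\<close> would, by monotonicity of the elasticity of \<open>f'\<close>, force \<open>f''\<close> to vanish
  all the way down to the origin.\<close>

lemma deriv2_pos:
  assumes "y > 0"
  shows "f'' y > 0"
proof (rule ccontr)
  assume "\<not> f'' y > 0"
  then have "f'' y = 0" using deriv2_nonneg[OF assms] by simp
  have zero: "f'' x = 0" if "0 < x" "x \<le> y" for x
  proof -
    have "x * f'' x / f' x \<le> 0" using deriv_elasticity_mono[OF that] \<open>f'' y = 0\<close> by simp
    then have "f'' x \<le> 0" using that deriv_pos[of x] by (simp add: divide_le_0_iff mult_le_0_iff)
    then show ?thesis using deriv2_nonneg[of x] that by simp
  qed
  have "f' y = f' 0"
  proof (rule DERIV_isconst_end[of 0 y f'])
    show "continuous_on {0..y} f'" using continuous(2) by (rule continuous_on_subset) auto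
    show "(f' has_real_derivative 0) (at x)" if "0 < x" "x < y" for x
      using deriv_at(2)[of x] zero[of x] that by simp
  qed (use assms in auto)
  then show False using deriv_pos[OF assms] by simp
qed

text \<open>\<open>G z\<close> is the convex conjugate of \<open>f\<close> at the marginal cost \<open>f' z\<close>. In the variable
  \<open>G \<circ> \<phi>\<close> the differential equation of the design space has a right-hand side with Lipschitz
  constant \<open>\<alpha> / y\<close>.\<close>

definition G :: "real \<Rightarrow> real" where
  "G z = z * f' z - f z"

lemma G_0 [simp]: "G 0 = 0"
  by (simp add: G_def)

lemma G_deriv_at:
  assumes "z > 0"
  shows "(G has_real_derivative z * f'' z) (at z)"
  unfolding G_def using deriv_at[OF assms] by (auto intro!: derivative_eq_intros)

lemma G_continuous: "continuous_on {0..} G"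
  unfolding G_def by (intro continuous_intros continuous)

text \<open>The Fenchel-Young inequality at the price \<open>f' z\<close>.\<close>

lemma conjugate_bound: "x \<ge> 0 \<Longrightarrow> z \<ge> 0 \<Longrightarrow> f' z * x - f x \<le> G z"
  using above_tangent[of x z] by (simp add: G_def algebra_simps)

text \<open>The tangent at \<open>b\<close>, evaluated at \<open>a\<close>. Read as a bound on the
  increment of \<open>f'\<close> per increment of \<open>G\<close>, it is the source of the
  Lipschitz constant.\<close>

lemma G_gap:
  assumes "0 \<le> a" "a \<le> b"
  shows "a * (f' b - f' a) \<le> G b - G a"
  using above_tangent[of a b] assms by (simp add: G_def algebra_simps)

lemma G_strict_mono:
  assumes "0 \<le> a" "a < b"
  shows "G a < G b"
proof (rule DERIV_pos_imp_increasing_open[OF assms(2)])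
  show "continuous_on {a..b} G" using assms by (intro continuous_on_subset[OF G_continuous]) auto
  show "\<exists>d. (G has_real_derivative d) (at z) \<and> d > 0" if "a < z" "z < b" for z
    using G_deriv_at[of z] deriv2_pos[of z] that assms by (intro exI[of _ "z * f'' z"]) auto
qed

lemma G_le_iff [simp]: "0 \<le> a \<Longrightarrow> 0 \<le> b \<Longrightarrow> G a \<le> G b \<longleftrightarrow> a \<le> b"
  using G_strict_mono[of a b] G_strict_mono[of b a] by (cases a b rule: linorder_cases) auto

lemma G_pos: "z > 0 \<Longrightarrow> G z > 0"
  using G_strict_mono[of 0 z] by simp

text \<open>Monotone elasticity of \<open>f'\<close> together with f' x >= f' 1 keeps the derivative
  x f'' x of \<open>G\<close> at least \<open>f'' 1\<close>. Hence \<open>G\<close> is unbounded and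
  maps the half-line onto itself.\<close>

lemma G_linear_growth:
  assumes "z \<ge> 1"
  shows "f'' 1 * (z - 1) \<le> G z"
proof -
  have "G 1 - f'' 1 * 1 \<le> G z - f'' 1 * z"
  proof (rule DERIV_nonneg_imp_nondecreasing[OF assms])
    fix x :: real assume x: "1 \<le> x"
    have "f' 1 > 0" "f' x \<ge> f' 1" using deriv_pos[of 1] deriv_mono[of 1 x] x by auto
    then have "f'' 1 \<le> f'' 1 / f' 1 * f' x"
      using deriv2_pos[of 1] by (simp add: field_simps)
    also have "\<dots> \<le> x * f'' x"
      using deriv_elasticity_mono[of 1 x] x \<open>f' 1 > 0\<close> \<open>f' x \<ge> f' 1\<close> by (simp add: field_simps)
    finally show "\<exists>d. ((\<lambda>x. G x - f'' 1 * x) has_real_derivative d) (at x) \<and> 0 \<le> d"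
      using G_deriv_at[of x] x
      by (intro exI[of _ "x * f'' x - f'' 1"]) (auto intro!: derivative_eq_intros)
  qed
  then show ?thesis using G_pos[of 1] by (simp add: algebra_simps)
qed

section \<open>The inverse of \<open>G\<close>\<close>

lemma G_surj:
  assumes "u \<ge> 0"
  shows "\<exists>z\<ge>0. G z = u"
proof -
  define b where "b = 1 + u / f'' 1"
  have "f'' 1 > 0" using deriv2_pos by simp
  then have "b \<ge> 1" "f'' 1 * (b - 1) = u" using assms by (auto simp: b_def)
  then have "G b \<ge> u" using G_linear_growth[of b] by simp
  moreover have "continuous_on {0..b} G" by (rule continuous_on_subset[OF G_continuous]) auto
  ultimately show ?thesis using IVT'[of G 0 u b] assms \<open>b \<ge> 1\<close> by auto
qed

definition Ginv :: "real \<Rightarrow> real" where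
  "Ginv u = the_inv_into {0..} G u"

lemma inj_G: "inj_on G {0..}"
  by (rule strict_mono_on_imp_inj_on) (auto simp: strict_mono_on_def G_strict_mono)

lemma Ginv_G [simp]: "z \<ge> 0 \<Longrightarrow> Ginv (G z) = z"
  using inj_G by (auto simp: Ginv_def intro: the_inv_into_f_f)

lemma G_Ginv [simp]: "u \<ge> 0 \<Longrightarrow> G (Ginv u) = u"
  and Ginv_nonneg: "u \<ge> 0 \<Longrightarrow> Ginv u \<ge> 0"
  using G_surj[of u] by auto

lemma Ginv_ge: "z \<ge> 0 \<Longrightarrow> G z \<le> u \<Longrightarrow> z \<le> Ginv u"
  using G_surj[of u] G_le_iff[of 0 z] by (metis Ginv_G G_0 G_le_iff order.trans order_refl)

lemma Ginv_le: "z \<ge> 0 \<Longrightarrow> 0 \<le> u \<Longrightarrow> u \<le> G z \<Longrightarrow> Ginv u \<le> z"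
  using G_surj[of u] by auto

lemma Ginv_pos:
  assumes "u > 0"
  shows "Ginv u > 0"
  using G_Ginv[of u] Ginv_nonneg[of u] assms by (cases "Ginv u = 0") auto

lemma Ginv_isCont:
  assumes "u > 0"
  shows "isCont Ginv u"
proof -
  define z where "z = Ginv u"
  have "z > 0" "G z = u" using Ginv_pos assms by (auto simp: z_def)
  have "isCont Ginv (G z)"
    by (rule isCont_inverse_function2[of "z/2" _ "z + 1"])
      (use \<open>z > 0\<close> in \<open>auto intro!: DERIV_isCont[OF G_deriv_at]\<close>)
  then show ?thesis by (simp add: \<open>G z = u\<close>)
qed

lemma Ginv_deriv:
  assumes "u > 0"
  shows "(Ginv has_real_derivative inverse (Ginv u * f'' (Ginv u))) (at u)"
  by (rule DERIV_inverse_function[where f = G and a = 0 and b = "u + 1"])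
    (use assms Ginv_pos[OF assms] deriv2_pos[of "Ginv u"] in
      \<open>auto intro: G_deriv_at Ginv_isCont\<close>)

text \<open>Arguments that are at least \<open>G y\<close> have \<open>Ginv\<close> values that are
  at least \<open>y\<close>, so \<open>G_gap\<close> applies with its factor bounded below by
  \<open>y\<close>.\<close>

lemma marginal_Ginv_lipschitz:
  assumes "y > 0" "G y \<le> u" "G y \<le> v"
  shows "\<bar>f' (Ginv u) - f' (Ginv v)\<bar> \<le> \<bar>u - v\<bar> / y"
proof -
  have *: "\<bar>f' (Ginv u) - f' (Ginv v)\<bar> \<le> \<bar>u - v\<bar> / y" if "G y \<le> u" "u \<le> v" for u v
  proof -
    have "u > 0" "v > 0" using G_pos[OF \<open>y > 0\<close>] that by auto
    have "y \<le> Ginv u" using Ginv_ge \<open>y > 0\<close> that by auto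
    have "Ginv u \<le> Ginv v" using Ginv_ge[of "Ginv u" v] \<open>u > 0\<close> that by (simp add: Ginv_nonneg)
    then have d: "0 \<le> f' (Ginv v) - f' (Ginv u)"
      using deriv_mono[of "Ginv u" "Ginv v"] \<open>u > 0\<close> by (simp add: Ginv_nonneg)
    have "y * (f' (Ginv v) - f' (Ginv u)) \<le> Ginv u * (f' (Ginv v) - f' (Ginv u))"
      using d \<open>y \<le> Ginv u\<close> by (rule mult_right_mono[rotated])
    also have "\<dots> \<le> v - u"
      using G_gap[of "Ginv u" "Ginv v"] \<open>Ginv u \<le> Ginv v\<close> \<open>u > 0\<close> \<open>v > 0\<close> by (simp add: Ginv_nonneg)
    finally show ?thesis using d \<open>y > 0\<close> that by (simp add: field_simps)
  qed
  show ?thesis using *[of u v] *[of v u] assms by (cases "u \<le> v") (auto simp: abs_minus_commute)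
qed

end

section \<open>Solutions through a given point\<close>

text \<open>Before the first time \<open>c\<close> with w c >= 0 the function is negative, hence
  nonincreasing, so w a >= w c.\<close>

lemma nonneg_backward:
  fixes w w' :: "real \<Rightarrow> real"
  assumes "a \<le> b" and w: "\<And>t. a \<le> t \<Longrightarrow> t \<le> b \<Longrightarrow> (w has_real_derivative w' t) (at t)"
    and w': "\<And>t. a \<le> t \<Longrightarrow> t \<le> b \<Longrightarrow> w t < 0 \<Longrightarrow> w' t \<le> 0" and "w b \<ge> 0"
  shows "w a \<ge> 0"
proof (rule ccontr)
  assume neg: "\<not> w a \<ge> 0"
  have cont: "continuous_on {a..b} w"
    using w by (intro continuous_at_imp_continuous_on) (meson DERIV_isCont atLeastAtMost_iff)
  have "closed {t \<in> {a..b}. 0 \<le> w t}"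
    by (intro closed_Collect_le continuous_on_closed_Collect_le cont continuous_intros closed_real_atLeastAtMost)
  moreover have "bounded {t \<in> {a..b}. 0 \<le> w t}"
    by (rule bounded_subset[of "{a..b}"]) auto
  ultimately have "compact {t \<in> {a..b}. 0 \<le> w t}" by (simp add: compact_eq_bounded_closed)
  then obtain c where c: "c \<in> {a..b}" "w c \<ge> 0" and least: "\<And>t. t \<in> {a..b} \<Longrightarrow> w t \<ge> 0 \<Longrightarrow> c \<le> t"
    using compact_attains_inf[of "{t \<in> {a..b}. 0 \<le> w t}"] \<open>a \<le> b\<close> \<open>w b \<ge> 0\<close> by fastforce
  have "w c \<le> w a"
  proof (rule DERIV_nonpos_imp_decreasing_open[of a c w])
    show "a \<le> c" using c by simp
    show "continuous_on {a..c} w" using c by (intro continuous_on_subset[OF cont]) auto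
    fix t assume "a < t" "t < c"
    then have "w t < 0" using least[of t] c by force
    then show "\<exists>y. (w has_real_derivative y) (at t) \<and> y \<le> 0"
      using w[of t] w'[of t] \<open>a < t\<close> \<open>t < c\<close> c by (intro exI[of _ "w' t"]) auto
  qed
  then show False using neg c by simp
qed

lemma nonneg_forward:
  fixes w w' :: "real \<Rightarrow> real"
  assumes "a \<le> b" and w: "\<And>t. a \<le> t \<Longrightarrow> t \<le> b \<Longrightarrow> (w has_real_derivative w' t) (at t)"
    and w': "\<And>t. a \<le> t \<Longrightarrow> t \<le> b \<Longrightarrow> w t < 0 \<Longrightarrow> w' t \<ge> 0" and "w a \<ge> 0"
  shows "w b \<ge> 0"
proof -
  have "w (- (- b)) \<ge> 0"
  proof (rule nonneg_backward[where w = "\<lambda>t. w (- t)" and a = "- b" and b = "- a" and w' = "\<lambda>t. - w' (- t)"])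
    fix t assume "- b \<le> t" "t \<le> - a"
    then show "((\<lambda>t. w (- t)) has_real_derivative - w' (- t)) (at t)"
      using w[of "- t"] by (simp add: DERIV_mirror)
  qed (use assms in auto)
  then show ?thesis by simp
qed

text \<open>\<open>reserve_growth\<close> weakens the equation of the design space to an inequality.
  In this form one reserve function of the envelope fits every cost of the family.\<close>

locale reserve = cost +
  fixes \<phi> d :: "real \<Rightarrow> real" and \<alpha> :: real
  assumes reserve_continuous: "continuous_on {0..} \<phi>" and reserve_0 [simp]: "\<phi> 0 = 0"
    and reserve_deriv: "\<And>y. y > 0 \<Longrightarrow> (\<phi> has_real_derivative d y) (at y)"
    and reserve_deriv_nonneg: "\<And>y. y > 0 \<Longrightarrow> d y \<ge> 0"
    and reserve_ge: "\<And>y. y > 0 \<Longrightarrow> \<phi> y \<ge> y"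
    and reserve_growth: "\<And>y. y > 0 \<Longrightarrow> \<phi> y * f'' (\<phi> y) * d y \<le> \<alpha> * (f' (\<phi> y) - f' y)"
    and rate: "\<alpha> \<ge> 1"
begin

lemma reserve_ge': "y \<ge> 0 \<Longrightarrow> \<phi> y \<ge> y"
  using reserve_ge[of y] by (cases "y = 0") auto

lemma G_reserve_deriv:
  assumes "y > 0"
  shows "((\<lambda>y. G (\<phi> y)) has_real_derivative \<phi> y * f'' (\<phi> y) * d y) (at y)"
  using DERIV_chain2[OF G_deriv_at reserve_deriv[OF assms]] reserve_ge[OF assms] assms by simp

text \<open>Below \<open>G y\<close>, where the differential equation has no meaning for the design space, the
  right-hand side is continued by \<open>0\<close>.\<close>

definition R :: "real \<Rightarrow> real \<Rightarrow> real" where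
  "R y x = \<alpha> * (f' (Ginv (max x (G y))) - f' y)"

lemma R_continuous: "continuous_on ({0<..} \<times> UNIV) (\<lambda>(y, x). R y x)"
proof -
  have "isCont (\<lambda>u. f' (Ginv u)) u" if "u > 0" for u
    using isCont_o2[OF Ginv_isCont[OF that]] DERIV_isCont[OF deriv_at(2)[OF Ginv_pos[OF that]]] .
  then have marginal: "continuous_on {0<..} (\<lambda>u. f' (Ginv u))"
    by (auto intro: continuous_at_imp_continuous_on)
  have fst: "continuous_on ({0<..} \<times> UNIV) (\<lambda>p :: real \<times> real. g (fst p))"
    if "continuous_on {0..} g" for g :: "real \<Rightarrow> real"
    by (rule continuous_on_compose2[OF that]) (auto intro!: continuous_intros)
  have "continuous_on ({0<..} \<times> UNIV) (\<lambda>p. max (snd p) (G (fst p)))"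
    by (intro continuous_intros fst G_continuous)
  from continuous_on_compose2[OF marginal this]
  have "continuous_on ({0<..} \<times> UNIV) (\<lambda>p. f' (Ginv (max (snd p) (G (fst p)))))"
    by (fastforce simp: less_max_iff_disj G_pos)
  then show ?thesis
    unfolding R_def case_prod_beta by (intro continuous_intros fst continuous(2))
qed

text \<open>Truncation by max is 1-Lipschitz and keeps both arguments in the range where the
  marginal cost is controlled.\<close>

lemma R_lipschitz:
  assumes "y > 0"
  shows "\<bar>R y x - R y x'\<bar> \<le> \<alpha> / y * \<bar>x - x'\<bar>"
proof -
  have "\<bar>R y x - R y x'\<bar> = \<alpha> * \<bar>f' (Ginv (max x (G y))) - f' (Ginv (max x' (G y)))\<bar>"
    using rate by (simp add: R_def abs_mult flip: right_diff_distrib)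
  also have "\<dots> \<le> \<alpha> * (\<bar>max x (G y) - max x' (G y)\<bar> / y)"
    using rate assms by (intro mult_left_mono marginal_Ginv_lipschitz) auto
  also have "\<dots> \<le> \<alpha> * (\<bar>x - x'\<bar> / y)"
    using rate assms by (intro mult_left_mono divide_right_mono) auto
  finally show ?thesis by simp
qed

lemma R_mono:
  assumes "y > 0" "x \<le> x'"
  shows "R y x \<le> R y x'"
proof -
  have pos: "max x (G y) > 0" "max x' (G y) > 0" using G_pos[OF assms(1)] by (auto simp: less_max_iff_disj)
  have "Ginv (max x (G y)) \<le> Ginv (max x' (G y))"
    using pos assms by (intro Ginv_ge Ginv_nonneg) auto
  then show ?thesis
    unfolding R_def using rate pos by (intro mult_left_mono diff_right_mono deriv_mono Ginv_nonneg) auto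
qed

text \<open>Solve for u = G o \<psi> with the value of V = G o \<phi> at \<open>y0\<close>, compare
  \<open>u\<close> with \<open>V\<close> on both sides of \<open>y0\<close>, and pull back by
  \<open>Ginv\<close>.\<close>

lemma design_space_through:
  assumes "y0 > 0"
  shows "\<exists>\<psi>\<in>design_space \<alpha> f. \<psi> y0 = \<phi> y0"
proof -
  define V where "V y = G (\<phi> y)" for y
  obtain u where u_y0: "u y0 = V y0"
    and u_deriv: "\<And>y. y > 0 \<Longrightarrow> (u has_real_derivative R y (u y)) (at y)"
    using ode_half_line[OF R_continuous R_lipschitz _ assms, of "V y0"] rate by auto
  have V_deriv: "(V has_real_derivative \<phi> y * f'' (\<phi> y) * d y) (at y)" if "y > 0" for y
    unfolding V_def using G_reserve_deriv[OF that] .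
  have V_ge: "V y \<ge> G y" if "y > 0" for y
    using reserve_ge[OF that] that by (simp add: V_def)
  have V_sub: "\<phi> y * f'' (\<phi> y) * d y \<le> R y (V y)" if "y > 0" for y
    using reserve_growth[OF that] reserve_ge[OF that] V_ge[OF that] that
    by (simp add: R_def max_absorb1) (simp add: V_def)
  \<comment> \<open>Where \<open>u\<close> exceeds \<open>V\<close>, monotonicity of
    \<open>R\<close> in its second argument gives u' >= V', the sign that backward comparison
    needs.\<close>
  have below: "u y \<le> V y" if "0 < y" "y \<le> y0" for y
  proof -
    have "V y - u y \<ge> 0"
    proof (rule nonneg_backward[OF \<open>y \<le> y0\<close>])
      fix t assume "y \<le> t" "t \<le> y0"
      then have "t > 0" using that by simp
      show "((\<lambda>t. V t - u t) has_real_derivative \<phi> t * f'' (\<phi> t) * d t - R t (u t)) (at t)"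
        using V_deriv u_deriv \<open>t > 0\<close> by (auto intro!: derivative_eq_intros)
      show "\<phi> t * f'' (\<phi> t) * d t - R t (u t) \<le> 0" if "V t - u t < 0"
        using V_sub[OF \<open>t > 0\<close>] R_mono[OF \<open>t > 0\<close>, of "V t" "u t"] that by simp
    qed (simp add: u_y0)
    then show ?thesis by simp
  qed
  have above: "u y \<ge> V y" if "y0 \<le> y" for y
  proof -
    \<comment> \<open>Forward, monotonicity of \<open>R\<close> has the wrong sign. Where u < V, the
      Lipschitz bound leaves (u - V)' >= (\<alpha> / t) (u - V), and the integrating factor absorbs
      the right-hand side.\<close>
    have "(u y - V y) * y powr (- \<alpha>) \<ge> 0"
    proof (rule nonneg_forward[OF \<open>y0 \<le> y\<close>])
      fix t assume "y0 \<le> t" "t \<le> y"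
      then have "t > 0" using assms by simp
      show "((\<lambda>t. (u t - V t) * t powr (- \<alpha>)) has_real_derivative
               (R t (u t) - \<phi> t * f'' (\<phi> t) * d t - \<alpha> / t * (u t - V t)) * t powr (- \<alpha>)) (at t)"
        using V_deriv u_deriv \<open>t > 0\<close>
        by (auto intro!: derivative_eq_intros simp: powr_diff field_simps)
      assume "(u t - V t) * t powr (- \<alpha>) < 0"
      then have "u t < V t" using \<open>t > 0\<close> by (auto simp: mult_less_0_iff)
      then have "R t (V t) - R t (u t) \<le> - (\<alpha> / t * (u t - V t))"
        using R_lipschitz[OF \<open>t > 0\<close>, of "V t" "u t"] by (simp add: abs_le_iff minus_mult_right minus_divide_left)
      then show "(R t (u t) - \<phi> t * f'' (\<phi> t) * d t - \<alpha> / t * (u t - V t)) * t powr (- \<alpha>) \<ge> 0"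
        using V_sub[OF \<open>t > 0\<close>] by (intro mult_nonneg_nonneg) auto
    qed (simp add: u_y0)
    then show ?thesis using assms that by (simp add: zero_le_mult_iff)
  qed
  have u_ge: "u y \<ge> G y" if "y > 0" for y
  proof (cases "y0 \<le> y")
    case True
    then show ?thesis using above[of y] V_ge[of y] that by simp
  next
    case False
    \<comment> \<open>Below \<open>G\<close> the truncated right-hand side is 0 while
      \<open>G\<close> increases, so u - G is nonincreasing there.\<close>
    have "u y - G y \<ge> 0"
    proof (rule nonneg_backward[of y y0])
      fix t assume "y \<le> t" "t \<le> y0"
      then have "t > 0" using that by simp
      show "((\<lambda>t. u t - G t) has_real_derivative R t (u t) - t * f'' t) (at t)"
        using G_deriv_at u_deriv \<open>t > 0\<close> by (auto intro!: derivative_eq_intros)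
      assume "u t - G t < 0"
      then have "R t (u t) = 0" using \<open>t > 0\<close> by (simp add: R_def max_absorb2)
      then show "R t (u t) - t * f'' t \<le> 0" using deriv2_pos[of t] \<open>t > 0\<close> by simp
    qed (use False u_y0 V_ge[OF assms] in auto)
    then show ?thesis by simp
  qed
  \<comment> \<open>\<open>u\<close> is controlled only at positive arguments, so the value at the
    origin is prescribed; continuity there comes from 0 <= \<psi> <= \<phi> on the interval up to
    \<open>y0\<close>.\<close>
  define \<psi> where "\<psi> y = (if y \<le> 0 then 0 else Ginv (u y))" for y
  have \<psi>_pos: "u y > 0" "\<psi> y = Ginv (u y)" "\<psi> y \<ge> y" if "y > 0" for y
    using u_ge[OF that] G_pos[OF that] Ginv_ge[of y "u y"] that by (auto simp: \<psi>_def)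
  have \<psi>_deriv: "(\<psi> has_real_derivative \<alpha> * ((f' (\<psi> y) - f' y) / (\<psi> y * f'' (\<psi> y)))) (at y)"
    if "y > 0" for y
  proof -
    have "((\<lambda>y. Ginv (u y)) has_real_derivative \<alpha> * ((f' (\<psi> y) - f' y) / (\<psi> y * f'' (\<psi> y)))) (at y)"
      using DERIV_chain2[OF Ginv_deriv[OF \<psi>_pos(1)[OF that]] u_deriv[OF that]] \<psi>_pos[OF that] u_ge[OF that]
      by (simp add: R_def max_absorb1 field_simps)
    then show ?thesis
      by (rule has_field_derivative_transform_within_open[where S = "{0<..}"])
        (use that in \<open>auto simp: \<psi>_def\<close>)
  qed
  have \<psi>_le: "\<psi> y \<le> \<phi> y" if "0 < y" "y \<le> y0" for y
    using Ginv_le[of "\<phi> y" "u y"] below[OF that] \<psi>_pos[OF that(1)] reserve_ge[OF that(1)] that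
    by (simp add: V_def)
  have "continuous_on {0..} \<psi>"
    unfolding continuous_on_eq_continuous_within
  proof
    fix y :: real assume "y \<in> {0..}"
    show "continuous (at y within {0..}) \<psi>"
    proof (cases "y = 0")
      case False
      then show ?thesis using \<open>y \<in> {0..}\<close> DERIV_isCont[OF \<psi>_deriv[of y]]
        by (auto intro: continuous_at_imp_continuous_at_within)
    next
      case True
      have "(\<psi> \<longlongrightarrow> 0) (at 0 within {0..})"
      proof (rule tendsto_sandwich)
        show "((\<lambda>_. 0) \<longlongrightarrow> (0::real)) (at 0 within {0..})" by simp
        show "(\<phi> \<longlongrightarrow> 0) (at 0 within {0..})"
          using reserve_continuous unfolding continuous_on_def by (force dest: bspec[of _ _ 0])
        have ev: "\<forall>\<^sub>F y in at 0 within {0..}. 0 < y \<and> y < y0"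
          unfolding eventually_at using assms by (intro exI[of _ y0]) auto
        show "\<forall>\<^sub>F y in at 0 within {0..}. 0 \<le> \<psi> y"
          using ev by eventually_elim (use \<psi>_pos in force)
        show "\<forall>\<^sub>F y in at 0 within {0..}. \<psi> y \<le> \<phi> y"
          using ev by eventually_elim (use \<psi>_le in auto)
      qed
      then show ?thesis using True by (simp add: continuous_within \<psi>_def)
    qed
  qed
  moreover have "\<alpha> * ((f' (\<psi> y) - f' y) / (\<psi> y * f'' (\<psi> y))) \<ge> 0" if "y > 0" for y
    using rate that \<psi>_pos(3)[OF that] deriv_mono[of y "\<psi> y"] deriv2_pos[of "\<psi> y"] by auto
  moreover have "\<psi> y \<ge> 0" if "y \<ge> 0" for y
    using \<psi>_pos(3)[of y] that by (cases "y = 0") (auto simp: \<psi>_def)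
  moreover have "\<psi> differentiable (at y)" if "y > 0" for y
    using \<psi>_deriv[OF that] by (auto simp: real_differentiable_def)
  ultimately have "\<psi> \<in> design_space \<alpha> f"
    unfolding design_space_def
    using \<psi>_pos(3) DERIV_imp_deriv[OF \<psi>_deriv]
    by (simp add: \<psi>_def[of 0])
  moreover have "\<psi> y0 = \<phi> y0"
    using assms u_y0 reserve_ge[OF assms] by (simp add: \<psi>_def V_def)
  ultimately show ?thesis by blast
qed

end

section \<open>The primal-dual argument\<close>

lemma utilization_snoc:
  "utilization A (I @ [d]) j = utilization A I j + snd d j * A (I @ [d]) j"
  by (simp add: utilization_def decisions_def nth_append)

lemma valid_instance_snoc:
  "valid_instance m (I @ [d]) \<longleftrightarrow> valid_instance m I \<and> (\<forall>j<m. fst d j \<ge> 0 \<and> snd d j > 0)"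
  by (auto simp: valid_instance_def)

text \<open>\<open>feasible m\<close> leaves the coordinates from \<open>m\<close> on free and is
  not compact as a set of functions. Setting them to 0 gives a closed subset of a product of compact
  sets.\<close>

lemma compact_truncated_feasible: "compact {x \<in> feasible m. \<forall>j\<ge>m. x j = 0}"
proof -
  let ?B = "Pi\<^sub>E UNIV (\<lambda>j. if j < m then {0..1} else {0 :: real})"
  have "compactin (product_topology (\<lambda>_. euclidean) UNIV) ?B"
    unfolding compactin_PiE by auto
  then have "compact ?B" by (simp add: euclidean_product_topology)
  moreover have "closed {x :: nat \<Rightarrow> real. (\<Sum>j<m. x j) \<le> 1}"
    by (intro closed_Collect_le continuous_intros continuous_on_product_coordinates)
  ultimately have "compact ({x. (\<Sum>j<m. x j) \<le> 1} \<inter> ?B)" by (rule closed_Int_compact[rotated])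
  moreover have "{x \<in> feasible m. \<forall>j\<ge>m. x j = 0} = {x. (\<Sum>j<m. x j) \<le> 1} \<inter> ?B"
  proof (intro equalityI subsetI)
    fix x assume x: "x \<in> {x \<in> feasible m. \<forall>j\<ge>m. x j = 0}"
    have "x j \<le> 1" if "j < m" for j
      using x that member_le_sum[of j "{..<m}" x] by (auto simp: feasible_def)
    then show "x \<in> {x. (\<Sum>j<m. x j) \<le> 1} \<inter> ?B" using x by (auto simp: feasible_def PiE_UNIV_domain)
  next
    fix x assume x: "x \<in> {x. (\<Sum>j<m. x j) \<le> 1} \<inter> ?B"
    then have "x j \<in> (if j < m then {0..1} else {0})" for j by (auto simp: PiE_UNIV_domain Pi_iff)
    then have "j < m \<Longrightarrow> x j \<ge> 0" "\<not> j < m \<Longrightarrow> x j = 0" for j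
      by (metis atLeastAtMost_iff, metis singletonD)
    then show "x \<in> {x \<in> feasible m. \<forall>j\<ge>m. x j = 0}"
      using x by (simp add: feasible_def)
  qed
  ultimately show ?thesis by simp
qed

lemma feasible_segment:
  assumes "x \<in> feasible m" "x' \<in> feasible m" "0 \<le> s" "s \<le> 1"
  shows "(\<lambda>j. x j + s * (x' j - x j)) \<in> feasible m"
proof -
  have eq: "x j + s * (x' j - x j) = (1 - s) * x j + s * x' j" for j by (simp add: algebra_simps)
  have "(\<Sum>j<m. (1 - s) * x j + s * x' j) = (1 - s) * (\<Sum>j<m. x j) + s * (\<Sum>j<m. x' j)"
    by (simp add: sum.distrib sum_distrib_left)
  also have "\<dots> \<le> (1 - s) * 1 + s * 1"
    using assms by (intro add_mono mult_left_mono) (auto simp: feasible_def)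
  finally show ?thesis using assms unfolding feasible_def eq by auto
qed

lemma derivative_nonpos_at_max:
  fixes g :: "real \<Rightarrow> real"
  assumes "(g has_real_derivative D) (at 0 within {0..1})"
    and "\<And>s. 0 \<le> s \<Longrightarrow> s \<le> 1 \<Longrightarrow> g s \<le> g 0"
  shows "D \<le> 0"
proof (rule tendsto_upperbound)
  show "((\<lambda>s. (g s - g 0) / (s - 0)) \<longlongrightarrow> D) (at 0 within {0..1})"
    using assms(1) by (simp add: has_field_derivative_iff)
  show "\<forall>\<^sub>F s in at 0 within {0..1}. (g s - g 0) / (s - 0) \<le> 0"
    unfolding eventually_at using assms(2)
    by (intro exI[of _ 1]) (auto simp: divide_le_0_iff)
  show "at (0::real) within {0..1} \<noteq> bot" by (simp add: trivial_limit_within islimpt_Icc)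
qed

section \<open>Posted prices and the optimality of a single decision\<close>

context reserve
begin

definition price :: "real \<Rightarrow> real" where
  "price \<eta> = f' (\<phi> \<eta>)"

text \<open>The cumulative posted price. Along a run the integrals in \<open>pseudo_utility\<close>
  telescope to \<open>J\<close> of the final utilization.\<close>

definition J :: "real \<Rightarrow> real" where
  "J y = integral {0..y} price"

lemma reserve_mono: "0 \<le> x \<Longrightarrow> x \<le> y \<Longrightarrow> \<phi> x \<le> \<phi> y"
  using reserve_continuous reserve_deriv reserve_deriv_nonneg by (rule nondecreasing_half_line)

lemma reserve_nonneg: "y \<ge> 0 \<Longrightarrow> \<phi> y \<ge> 0"
  using reserve_ge'[of y] by simp

lemma price_mono: "0 \<le> x \<Longrightarrow> x \<le> y \<Longrightarrow> price x \<le> price y"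
  unfolding price_def using reserve_mono by (intro deriv_mono reserve_nonneg) auto

lemma price_continuous: "continuous_on {0..} price"
  unfolding price_def
  by (rule continuous_on_compose2[OF continuous(2) reserve_continuous]) (auto intro: reserve_nonneg)

lemma J_0 [simp]: "J 0 = 0"
  by (simp add: J_def)

lemma J_deriv:
  assumes "y \<ge> 0"
  shows "(J has_real_derivative price y) (at y within {0..})"
proof -
  have "(J has_real_derivative price y) (at y within {0..y + 1})"
    unfolding J_def using assms
    by (intro integral_has_real_derivative continuous_on_subset[OF price_continuous]) auto
  moreover have "at y within {0..y + 1} = at y within {0..}"
    by (rule at_within_nhd[where S = "{..<y + 1}"]) auto
  ultimately show ?thesis by simp
qed

lemma J_continuous: "continuous_on {0..} J"
  by (rule DERIV_continuous_on[OF J_deriv]) auto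

lemma price_integrable: "0 \<le> a \<Longrightarrow> price integrable_on {a..b}"
  by (intro integrable_continuous_real continuous_on_subset[OF price_continuous]) auto

lemma J_diff: "0 \<le> a \<Longrightarrow> a \<le> b \<Longrightarrow> integral {a..b} price = J b - J a"
  unfolding J_def
  using Henstock_Kurzweil_Integration.integral_combine[OF _ _ price_integrable, of 0 a b] by simp

lemma J_diff_le:
  assumes "0 \<le> a" "a \<le> b"
  shows "J b - J a \<le> price b * (b - a)"
proof -
  have "integral {a..b} price \<le> integral {a..b} (\<lambda>_. price b)"
    using assms by (intro integral_le price_integrable price_mono) auto
  then show ?thesis using assms J_diff[OF assms] by (simp add: mult.commute)
qed

text \<open>The pointwise inequality to which competitiveness reduces: the differential inequality for
  \<open>\<phi>\<close> is its derivative.\<close>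

lemma conjugate_le_profit:
  assumes "y \<ge> 0"
  shows "G (\<phi> y) \<le> \<alpha> * (J y - f y)"
proof -
  have "\<alpha> * (J 0 - f 0) - G (\<phi> 0) \<le> \<alpha> * (J y - f y) - G (\<phi> y)"
  proof (rule nondecreasing_half_line[OF _ _ _ order_refl assms])
    show "continuous_on {0..} (\<lambda>y. \<alpha> * (J y - f y) - G (\<phi> y))"
      by (intro continuous_intros J_continuous continuous(1)
          continuous_on_compose2[OF G_continuous reserve_continuous]) (auto intro: reserve_nonneg)
    fix y :: real assume "y > 0"
    then have "(J has_real_derivative price y) (at y)" using J_deriv[of y] by (simp add: at_within_half_line)
    then show "((\<lambda>y. \<alpha> * (J y - f y) - G (\<phi> y)) has_real_derivative
        \<alpha> * (price y - f' y) - \<phi> y * f'' (\<phi> y) * d y) (at y)"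
      using deriv_at(1)[OF \<open>y > 0\<close>] G_reserve_deriv[OF \<open>y > 0\<close>]
      by (auto intro!: derivative_eq_intros)
    show "\<alpha> * (price y - f' y) - \<phi> y * f'' (\<phi> y) * d y \<ge> 0"
      using reserve_growth[OF \<open>y > 0\<close>] by (simp add: price_def)
  qed
  then show ?thesis by simp
qed

lemma pseudo_utility_eq:
  assumes "\<And>j. j < m \<Longrightarrow> y j \<ge> 0" "\<And>j. j < m \<Longrightarrow> snd dem j > 0" "\<And>j. j < m \<Longrightarrow> x j \<ge> 0"
  shows "pseudo_utility m f \<phi> y dem x =
    (\<Sum>j<m. fst dem j * x j - (J (y j + snd dem j * x j) - J (y j)))"
proof -
  have "integral {y j..y j + snd dem j * x j} (\<lambda>\<eta>. f' (\<phi> \<eta>)) = J (y j + snd dem j * x j) - J (y j)"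
    if "j < m" for j
    using J_diff[of "y j" "y j + snd dem j * x j"] assms[OF that]
    by (simp add: price_def[abs_def])
  then show ?thesis by (simp add: pseudo_utility_def sum_subtractf)
qed

text \<open>The utility is continuous and sees only the coordinates below \<open>m\<close>, so a
  maximum over the compact truncated set is one over all feasible decisions.\<close>

lemma pseudo_utility_argmax_exists:
  assumes y: "\<And>j. j < m \<Longrightarrow> y j \<ge> 0" and w: "\<And>j. j < m \<Longrightarrow> snd dem j > 0"
  shows "\<exists>x. is_arg_max (pseudo_utility m f \<phi> y dem) (\<lambda>x. x \<in> feasible m) x"
proof -
  let ?S = "{x \<in> feasible m. \<forall>j\<ge>m. x j = 0}"
  let ?g = "\<lambda>x. \<Sum>j<m. fst dem j * x j - (J (y j + snd dem j * x j) - J (y j))"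
  have coord: "continuous_on ?S (\<lambda>x. x j)" for j
    using continuous_on_product_coordinates by (rule continuous_on_subset) simp
  have "continuous_on ?S (\<lambda>x. J (y j + snd dem j * x j))" if "j < m" for j
    by (rule continuous_on_compose2[OF J_continuous], intro continuous_intros coord)
      (use y[OF that] w[OF that] that in \<open>auto simp: feasible_def\<close>)
  then have "continuous_on ?S ?g" by (intro continuous_intros coord) auto
  moreover have "(\<lambda>_. 0) \<in> ?S" by (simp add: feasible_def)
  ultimately obtain x where x: "x \<in> ?S" "\<And>z. z \<in> ?S \<Longrightarrow> ?g z \<le> ?g x"
    using continuous_attains_sup[OF compact_truncated_feasible, of m ?g] by blast
  have "pseudo_utility m f \<phi> y dem z \<le> pseudo_utility m f \<phi> y dem x" if z: "z \<in> feasible m" for z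
  proof -
    define z' where "z' j = (if j < m then z j else 0)" for j
    have "z' \<in> ?S" using z by (auto simp: z'_def feasible_def)
    have "pseudo_utility m f \<phi> y dem z = ?g z" "pseudo_utility m f \<phi> y dem x = ?g x"
      using z x y w by (auto intro!: pseudo_utility_eq simp: feasible_def)
    moreover have "?g z = ?g z'" by (simp add: z'_def)
    ultimately show ?thesis using x(2)[OF \<open>z' \<in> ?S\<close>] by simp
  qed
  then show ?thesis using x(1) by (intro exI[of _ x]) (auto simp: is_arg_max_def not_less)
qed

text \<open>Along the segment from \<open>x\<close> to \<open>z\<close> the utility has its maximum
  at the start, so its one-sided derivative there is not positive. The prices are those after the
  decision, as \<open>price\<close> is the derivative of \<open>J\<close>.\<close>

lemma argmax_first_order:
  assumes y: "\<And>j. j < m \<Longrightarrow> y j \<ge> 0" and w: "\<And>j. j < m \<Longrightarrow> snd dem j > 0"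
    and max: "is_arg_max (pseudo_utility m f \<phi> y dem) (\<lambda>x. x \<in> feasible m) x"
    and z: "z \<in> feasible m"
  shows "(\<Sum>j<m. (fst dem j - price (y j + snd dem j * x j) * snd dem j) * (z j - x j)) \<le> 0"
proof -
  have x: "x \<in> feasible m" using max by (simp add: is_arg_max_def)
  define p where "p s j = x j + s * (z j - x j)" for s j
  have p: "p s \<in> feasible m" if "0 \<le> s" "s \<le> 1" for s
    using feasible_segment[OF x z that] by (simp add: p_def[abs_def])
  have p_nonneg: "y j + snd dem j * p s j \<ge> 0" if "0 \<le> s" "s \<le> 1" "j < m" for s j
    using p[OF that(1,2)] y[OF that(3)] w[OF that(3)] that(3) by (auto simp: feasible_def)
  define g where "g s = (\<Sum>j<m. fst dem j * p s j - (J (y j + snd dem j * p s j) - J (y j)))" for s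
  have util: "pseudo_utility m f \<phi> y dem (p s) = g s" if "0 \<le> s" "s \<le> 1" for s
    unfolding g_def using p[OF that] y w by (intro pseudo_utility_eq) (auto simp: feasible_def)
  have "p 0 = x" by (simp add: p_def fun_eq_iff)
  show ?thesis
  proof (rule derivative_nonpos_at_max)
    \<comment> \<open>The derivative of \<open>J\<close> is known within the half-line only, so the
      chain rule is used within the image of the segment.\<close>
    have "((\<lambda>s. J (y j + snd dem j * p s j)) has_real_derivative
        price (y j + snd dem j * x j) * (snd dem j * (z j - x j))) (at 0 within {0..1})" if "j < m" for j
    proof -
      have "((\<lambda>s. y j + snd dem j * p s j) has_real_derivative snd dem j * (z j - x j)) (at 0 within {0..1})"
        unfolding p_def by (auto intro!: derivative_eq_intros)
      moreover have "(J has_real_derivative price (y j + snd dem j * x j))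
          (at (y j + snd dem j * p 0 j) within (\<lambda>s. y j + snd dem j * p s j) ` {0..1})"
        using J_deriv[OF p_nonneg[of 0 j]] p_nonneg that \<open>p 0 = x\<close>
        by (auto intro: has_field_derivative_subset)
      ultimately show ?thesis
        using DERIV_image_chain[of J _ "\<lambda>s. y j + snd dem j * p s j" 0 "{0..1}"] by (simp add: o_def)
    qed
    moreover have "((\<lambda>s. fst dem j * p s j) has_real_derivative fst dem j * (z j - x j)) (at 0 within {0..1})" for j
      unfolding p_def by (auto intro!: derivative_eq_intros)
    ultimately have "(g has_real_derivative (\<Sum>j<m. fst dem j * (z j - x j) -
        (price (y j + snd dem j * x j) * (snd dem j * (z j - x j)) - 0))) (at 0 within {0..1})"
      unfolding g_def by (intro DERIV_sum DERIV_diff DERIV_const) auto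
    then show "(g has_real_derivative
        (\<Sum>j<m. (fst dem j - price (y j + snd dem j * x j) * snd dem j) * (z j - x j))) (at 0 within {0..1})"
      by (simp add: algebra_simps)
    show "g s \<le> g 0" if "0 \<le> s" "s \<le> 1" for s
      using max p[OF that] util[OF that] util[of 0] \<open>p 0 = x\<close>
      by (auto simp: is_arg_max_def not_less)
  qed
qed

text \<open>Raising prices to \<open>l\<close> lowers the left side, first-order optimality replaces
  \<open>z\<close> by \<open>x\<close>, and monotone prices bound the increment of \<open>J\<close>
  by the last price times the amount sold.\<close>

lemma argmax_dominates:
  assumes y: "\<And>j. j < m \<Longrightarrow> y j \<ge> 0" and w: "\<And>j. j < m \<Longrightarrow> snd dem j > 0"
    and max: "is_arg_max (pseudo_utility m f \<phi> y dem) (\<lambda>x. x \<in> feasible m) x"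
    and z: "z \<in> feasible m"
    and l: "\<And>j. j < m \<Longrightarrow> price (y j + snd dem j * x j) \<le> l j"
  shows "(\<Sum>j<m. (fst dem j - l j * snd dem j) * z j) \<le>
    (\<Sum>j<m. fst dem j * x j) - (\<Sum>j<m. J (y j + snd dem j * x j) - J (y j))"
proof -
  have x: "x \<in> feasible m" using max by (simp add: is_arg_max_def)
  let ?p = "\<lambda>j. price (y j + snd dem j * x j)"
  have "(\<Sum>j<m. (fst dem j - l j * snd dem j) * z j) \<le> (\<Sum>j<m. (fst dem j - ?p j * snd dem j) * z j)"
    using z l w by (intro sum_mono mult_right_mono diff_left_mono) (auto simp: feasible_def less_imp_le)
  also have "\<dots> \<le> (\<Sum>j<m. (fst dem j - ?p j * snd dem j) * x j)"
    using argmax_first_order[OF y w max z] by (simp add: right_diff_distrib sum_subtractf)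
  also have "\<dots> = (\<Sum>j<m. fst dem j * x j - ?p j * (snd dem j * x j))"
    by (simp add: algebra_simps)
  also have "\<dots> \<le> (\<Sum>j<m. fst dem j * x j - (J (y j + snd dem j * x j) - J (y j)))"
    using x y w J_diff_le[of "y j" "y j + snd dem j * x j" for j]
    by (intro sum_mono diff_left_mono) (auto simp: feasible_def less_imp_le)
  finally show ?thesis by (simp add: sum_subtractf)
qed

section \<open>Existence and competitiveness of PUMax\<close>

lemma PUMax_exists: "\<exists>A. PUMax m f \<phi> A"
proof -
  define best where "best y dem =
    (SOME x. is_arg_max (pseudo_utility m f \<phi> y dem) (\<lambda>x. x \<in> feasible m) x)" for y dem
  have best: "is_arg_max (pseudo_utility m f \<phi> y dem) (\<lambda>x. x \<in> feasible m) (best y dem)"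
    if "\<And>j. j < m \<Longrightarrow> y j \<ge> 0" "\<And>j. j < m \<Longrightarrow> snd dem j > 0" for y dem
    unfolding best_def by (rule someI_ex[OF pseudo_utility_argmax_exists[OF that]])
  \<comment> \<open>The algorithm refers to the utilization that it produces itself. Computing that
    utilization first, by recursion over the demands, breaks the circle.\<close>
  define load where "load = foldl (\<lambda>y dem j. y j + snd dem j * best y dem j) (\<lambda>_. 0)"
  define A where "A I = best (load (butlast I)) (last I)" for I
  have load: "utilization A I = load I" for I
  proof (induction I rule: rev_induct)
    case Nil
    then show ?case by (simp add: utilization_def load_def fun_eq_iff)
  next
    case (snoc dem I)
    then show ?case
      by (auto simp: fun_eq_iff utilization_snoc A_def) (simp add: load_def)
  qed
  have load_nonneg: "\<forall>j<m. load I j \<ge> 0" if "valid_instance m I" for I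
    using that
  proof (induction I rule: rev_induct)
    case Nil
    then show ?case by (simp add: load_def)
  next
    case (snoc dem I)
    then have I: "\<forall>j<m. load I j \<ge> 0" and w: "\<forall>j<m. snd dem j > 0"
      by (auto simp: valid_instance_snoc)
    then have "best (load I) dem \<in> feasible m" using best by (auto simp: is_arg_max_def)
    moreover have "load (I @ [dem]) j = load I j + snd dem j * best (load I) dem j" for j
      by (simp add: load_def)
    ultimately show ?case using I w by (auto simp: feasible_def less_imp_le)
  qed
  have "PUMax m f \<phi> A"
    unfolding PUMax_def load valid_instance_snoc
    using load_nonneg by (auto simp: A_def intro!: best)
  then show ?thesis by blast
qed

lemma PUMax_utilization_nonneg:
  assumes A: "PUMax m f \<phi> A" and "valid_instance m I" "j < m"
  shows "utilization A I j \<ge> 0"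
  using assms(2)
proof (induction I rule: rev_induct)
  case Nil
  then show ?case by (simp add: utilization_def)
next
  case (snoc dem I)
  then have "A (I @ [dem]) \<in> feasible m" using A unfolding PUMax_def is_arg_max_def by blast
  then show ?case using snoc \<open>j < m\<close>
    by (auto simp: utilization_snoc valid_instance_snoc feasible_def less_imp_le)
qed

text \<open>The prices \<open>l\<close> are left free, rather than fixed to the final ones, for the sake of the
  induction on the instance.\<close>

lemma PUMax_primal_dual:
  assumes A: "PUMax m f \<phi> A" and "valid_instance m I"
    and "\<And>t. t < length I \<Longrightarrow> x t \<in> feasible m"
    and "\<And>j. j < m \<Longrightarrow> price (utilization A I j) \<le> l j"
  shows "(\<Sum>t<length I. \<Sum>j<m. (fst (I ! t) j - l j * snd (I ! t) j) * x t j) \<le>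
    (\<Sum>t<length I. \<Sum>j<m. fst (I ! t) j * decisions A I t j) - (\<Sum>j<m. J (utilization A I j))"
  using assms(2-4)
proof (induction I rule: rev_induct)
  case Nil
  then show ?case by (simp add: utilization_def)
next
  case (snoc dem I)
  let ?x = "A (I @ [dem])"
  let ?y = "utilization A I"
  have valid: "valid_instance m I" and w: "\<And>j. j < m \<Longrightarrow> snd dem j > 0"
    using snoc.prems(1) by (auto simp: valid_instance_snoc)
  have y: "?y j \<ge> 0" if "j < m" for j using PUMax_utilization_nonneg[OF A valid that] .
  have max: "is_arg_max (pseudo_utility m f \<phi> ?y dem) (\<lambda>x. x \<in> feasible m) ?x"
    using A snoc.prems(1) unfolding PUMax_def by blast
  then have x: "?x \<in> feasible m" by (simp add: is_arg_max_def)
  have l: "price (?y j + snd dem j * ?x j) \<le> l j" if "j < m" for j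
    using snoc.prems(3)[OF that] by (simp add: utilization_snoc)
  have "price (?y j) \<le> l j" if "j < m" for j
    using price_mono[of "?y j" "?y j + snd dem j * ?x j"] y[OF that] w[OF that] x l[OF that] that
    by (fastforce simp: feasible_def less_imp_le)
  then have IH: "(\<Sum>t<length I. \<Sum>j<m. (fst (I ! t) j - l j * snd (I ! t) j) * x t j) \<le>
      (\<Sum>t<length I. \<Sum>j<m. fst (I ! t) j * decisions A I t j) - (\<Sum>j<m. J (?y j))"
    using snoc.prems(2) by (intro snoc.IH valid) auto
  have "(\<Sum>j<m. (fst dem j - l j * snd dem j) * x (length I) j) \<le>
      (\<Sum>j<m. fst dem j * ?x j) - (\<Sum>j<m. J (?y j + snd dem j * ?x j) - J (?y j))"
    by (rule argmax_dominates[OF y w max _ l]) (use snoc.prems(2) in auto)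
  moreover have "(\<Sum>t<length I. \<Sum>j<m. fst ((I @ [dem]) ! t) j * decisions A (I @ [dem]) t j) =
      (\<Sum>t<length I. \<Sum>j<m. fst (I ! t) j * decisions A I t j)"
    by (intro sum.cong refl) (auto simp: nth_append decisions_def)
  moreover have "(\<Sum>t<length I. \<Sum>j<m. (fst ((I @ [dem]) ! t) j - l j * snd ((I @ [dem]) ! t) j) * x t j) =
      (\<Sum>t<length I. \<Sum>j<m. (fst (I ! t) j - l j * snd (I ! t) j) * x t j)"
    by (intro sum.cong refl) (auto simp: nth_append)
  ultimately show ?case using IH
    by (simp add: utilization_snoc sum_subtractf) (simp add: decisions_def)
qed

text \<open>At the final prices the offline objective splits into price-adjusted values, bounded by
  the primal-dual inequality, and terms price * s - f s, bounded by the conjugate and then by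
  \<alpha> times the profit J - f.\<close>

lemma PUMax_competitive:
  assumes A: "PUMax m f \<phi> A"
  shows "competitive m f \<alpha> A"
proof -
  have "A I \<in> feasible m" if "valid_instance m I" "I \<noteq> []" for I
    using that A by (cases I rule: rev_cases) (auto simp: PUMax_def is_arg_max_def)
  moreover have "OPT m f I \<le> \<alpha> * ALG m f A I" if I: "valid_instance m I" for I
    unfolding OPT_def
  proof (rule cSUP_least)
    show "{x. \<forall>t<length I. x t \<in> feasible m} \<noteq> {}"
      by (auto intro!: exI[of _ "\<lambda>_ _. 0"] simp: feasible_def)
    fix x assume "x \<in> {x. \<forall>t<length I. x t \<in> feasible m}"
    then have x: "\<And>t. t < length I \<Longrightarrow> x t \<in> feasible m" by simp
    define y where "y = utilization A I"
    define s where "s j = (\<Sum>t<length I. snd (I ! t) j * x t j)" for j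
    define B where "B = (\<Sum>t<length I. \<Sum>j<m. fst (I ! t) j * decisions A I t j) - (\<Sum>j<m. J (y j))"
    have y: "y j \<ge> 0" if "j < m" for j
      unfolding y_def using PUMax_utilization_nonneg[OF A I that] .
    have s: "s j \<ge> 0" if "j < m" for j
      unfolding s_def
    proof (intro sum_nonneg mult_nonneg_nonneg)
      fix t assume "t \<in> {..<length I}"
      then have "I ! t \<in> set I" "x t \<in> feasible m" using x by auto
      then show "snd (I ! t) j \<ge> 0" "x t j \<ge> 0"
        using I that by (fastforce simp: valid_instance_def feasible_def case_prod_beta less_imp_le)+
    qed
    have bound: "(\<Sum>t<length I. \<Sum>j<m. (fst (I ! t) j - price (y j) * snd (I ! t) j) * z t j) \<le> B"
      if "\<And>t. t < length I \<Longrightarrow> z t \<in> feasible m" for z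
      unfolding B_def y_def by (rule PUMax_primal_dual[OF A I that]) auto
    \<comment> \<open>Testing with the zero decisions; nonnegativity lets \<open>B\<close> be scaled
      up by \<alpha> below.\<close>
    have "B \<ge> 0" using bound[of "\<lambda>_ _. 0"] by (simp add: feasible_def)
    have "objective m f I x = (\<Sum>t<length I. \<Sum>j<m. (fst (I ! t) j - price (y j) * snd (I ! t) j) * x t j)
        + (\<Sum>j<m. price (y j) * s j - f (s j))"
    proof -
      have "(\<Sum>j<m. price (y j) * s j) = (\<Sum>t<length I. \<Sum>j<m. price (y j) * snd (I ! t) j * x t j)"
        unfolding s_def by (subst sum.swap) (simp add: sum_distrib_left mult.assoc)
      then show ?thesis by (simp add: objective_def s_def left_diff_distrib sum_subtractf)
    qed
    also have "\<dots> \<le> B + (\<Sum>j<m. G (\<phi> (y j)))"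
      using bound[OF x] conjugate_bound[of "s j" "\<phi> (y j)" for j] y s
      by (intro add_mono sum_mono) (auto simp: price_def reserve_nonneg)
    also have "\<dots> \<le> B + (\<Sum>j<m. \<alpha> * (J (y j) - f (y j)))"
      using conjugate_le_profit y by (intro add_left_mono sum_mono) auto
    also have "\<dots> \<le> \<alpha> * B + (\<Sum>j<m. \<alpha> * (J (y j) - f (y j)))"
      using \<open>B \<ge> 0\<close> rate by (simp add: mult_le_cancel_right1)
    \<comment> \<open>The \<open>J\<close> terms of \<open>B\<close> cancel against those of the
      profits.\<close>
    also have "\<dots> = \<alpha> * ALG m f A I"
      unfolding ALG_def objective_def B_def y_def utilization_def
      by (simp add: sum_subtractf algebra_simps flip: sum_distrib_left)
    finally show "objective m f I x \<le> \<alpha> * ALG m f A I" .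
  qed
  ultimately show ?thesis by (auto simp: competitive_def online_algorithm_def)
qed

lemma reserve_competitive: "reserve_competitive m f \<alpha> \<phi>"
  using PUMax_exists PUMax_competitive by (auto simp: reserve_competitive_def)

end

section \<open>The safe envelope\<close>

lemma piece_neighbourhood:
  assumes fin: "\<And>b. finite (Y \<inter> {..b})" and y: "y \<in> piece Y s"
  shows "\<exists>e>0. {y - e<..<y + e} \<subseteq> piece Y s"
proof -
  \<comment> \<open>The extra element y + 1 gives \<open>Z\<close> a minimum even if no switching
    point follows nearby.\<close>
  define Z where "Z = insert (y + 1) {z \<in> Y. s < z \<and> z \<le> y + 1}"
  have "finite {z \<in> Y. s < z \<and> z \<le> y + 1}"
    by (rule finite_subset[OF _ fin[of "y + 1"]]) auto
  then have Z: "finite Z" "Z \<noteq> {}" by (auto simp: Z_def)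
  have "Min Z > y" using Z y by (auto simp: Z_def piece_def)
  moreover have "z \<ge> Min Z" if "z \<in> Y" "s < z" for z
  proof (cases "z \<le> y + 1")
    case True
    then show ?thesis using that Z by (intro Min_le) (auto simp: Z_def)
  next
    case False
    have "Min Z \<le> y + 1" using Z by (intro Min_le) (auto simp: Z_def)
    then show ?thesis using False by simp
  qed
  ultimately have "{s<..<Min Z} \<subseteq> piece Y s" by (force simp: piece_def)
  moreover have "y > s" using y by (simp add: piece_def)
  ultimately show ?thesis using \<open>Min Z > y\<close>
    by (intro exI[of _ "min (y - s) (Min Z - y)"]) (auto simp: min_def split: if_splits)
qed

text \<open>The left endpoint is the largest among 0 and the switching points up to
  \<open>y\<close>; it exists by local finiteness.\<close>

lemma in_some_piece:
  assumes fin: "\<And>b. finite (Y \<inter> {..b})" and "y > 0" "y \<notin> Y"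
  shows "\<exists>s\<in>insert 0 Y. s \<ge> 0 \<and> y \<in> piece Y s"
proof -
  define Z where "Z = insert 0 (Y \<inter> {..y})"
  have Z: "finite Z" "Z \<noteq> {}" using fin by (auto simp: Z_def)
  have "Max Z \<in> Z" using Z by (rule Max_in)
  then have "Max Z \<in> insert 0 Y" "Max Z < y" using assms by (auto simp: Z_def less_le)
  moreover have "Max Z \<ge> 0" using Z by (intro Max_ge) (auto simp: Z_def)
  moreover have "y < z" if "z \<in> Y" "Max Z < z" for z
    using that Z Max_ge[of Z z] by (force simp: Z_def)
  ultimately show ?thesis by (auto simp: piece_def)
qed

text \<open>The index set is finite and nonempty, so a maximizer exists and \<open>LEAST\<close>
  picks one.\<close>

lemma kstar_maximal:
  assumes "K \<ge> 1"
  shows "kstar K f y \<in> {1..K}"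
    and "k \<in> {1..K} \<Longrightarrow>
      elasticity (hderiv (hderiv (f k))) y \<le> elasticity (hderiv (hderiv (f (kstar K f y)))) y"
proof -
  let ?E = "\<lambda>k. elasticity (hderiv (hderiv (f k))) y"
  have ne: "finite (?E ` {1..K})" "?E ` {1..K} \<noteq> {}" using assms by auto
  then obtain k0 where k0: "k0 \<in> {1..K}" "Max (?E ` {1..K}) = ?E k0" using Max_in[OF ne] by (elim imageE) blast
  have "is_arg_max ?E (\<lambda>k. k \<in> {1..K}) k0"
    using k0 ne by (auto simp: is_arg_max_def not_less simp flip: k0(2))
  then have "is_arg_max ?E (\<lambda>k. k \<in> {1..K}) (kstar K f y)"
    unfolding kstar_def by (rule LeastI)
  then show "kstar K f y \<in> {1..K}" "k \<in> {1..K} \<Longrightarrow> ?E k \<le> ?E (kstar K f y)"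
    by (auto simp: is_arg_max_def not_less)
qed

text \<open>For a continuous function the fundamental theorem of calculus tolerates finitely many
  exceptional points. This lets the monotonicity argument cross switching points.\<close>

lemma nondecreasing_except_finite:
  fixes r r' :: "real \<Rightarrow> real"
  assumes "finite S" "a \<le> b" "continuous_on {a..b} r"
    and "\<And>x. x \<in> {a..b} - S \<Longrightarrow> \<exists>d\<ge>0. (r has_real_derivative d) (at x)"
  shows "r a \<le> r b"
proof -
  obtain d where d: "\<And>x. x \<in> {a..b} - S \<Longrightarrow> d x \<ge> 0 \<and> (r has_real_derivative d x) (at x)"
    using assms(4) by metis
  define d' where "d' x = (if x \<in> S then 0 else d x)" for x
  have "(d' has_integral (r b - r a)) {a..b}"
    by (rule fundamental_theorem_of_calculus_strong[OF assms(1,2) _ assms(3)])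
      (use d in \<open>auto simp: d'_def has_real_derivative_iff_has_vector_derivative\<close>)
  then have "0 \<le> r b - r a"
    by (rule has_integral_nonneg) (use d in \<open>auto simp: d'_def\<close>)
  then show ?thesis by simp
qed

section \<open>Domination by the envelope\<close>

locale envelope =
  fixes K :: nat and f :: "nat \<Rightarrow> real \<Rightarrow> real" and h :: "real \<Rightarrow> real"
  assumes K: "K \<ge> 1" and costs: "\<And>k. k \<in> {1..K} \<Longrightarrow> cost_function (f k)"
    and envelope: "safe_envelope K f h"
begin

abbreviation "h' \<equiv> hderiv h"
abbreviation "h'' \<equiv> hderiv h'"

lemma envelope_smooth: "h differentiable_on {0..}" "h' differentiable_on {0..}" "continuous_on {0..} h''"
  using envelope by (auto simp: safe_envelope_def twice_cont_diff_hl_def)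

lemma envelope_deriv2_at: "y > 0 \<Longrightarrow> (h' has_real_derivative h'' y) (at y)"
  using hderiv_works[OF envelope_smooth(2), of y] by (simp add: at_within_half_line)

text \<open>Two derivatives remove the affine part of a piece. Phrased on neighbourhoods, the
  statement hides the bookkeeping of pieces and keeps what the ratio argument uses.\<close>

lemma envelope_local_form:
  "\<exists>Y. (\<forall>b. finite (Y \<inter> {..b})) \<and>
     (\<forall>y>0. y \<notin> Y \<longrightarrow> (\<exists>C>0. \<exists>e>0. \<exists>j\<in>{1..K}. e \<le> y \<and> (\<forall>x\<in>{y - e<..<y + e}.
        h'' x = C * hderiv (hderiv (f j)) x \<and>
        (\<forall>k\<in>{1..K}. elasticity (hderiv (hderiv (f k))) x \<le> elasticity (hderiv (hderiv (f j))) x))))"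
proof -
  obtain Y \<kappa> C p q where Y: "switching_points K f Y \<kappa>"
    and form: "\<And>s. s \<in> insert 0 Y \<Longrightarrow> C s > 0"
      "\<And>s y. s \<in> insert 0 Y \<Longrightarrow> y \<in> piece Y s \<Longrightarrow> h y = C s * f (\<kappa> s) y + (p s + q s * y)"
    using envelope unfolding safe_envelope_def by blast
  have fin: "finite (Y \<inter> {..b})" for b using Y by (auto simp: switching_points_def)
  have "\<exists>C>0. \<exists>e>0. \<exists>j\<in>{1..K}. e \<le> y \<and> (\<forall>x\<in>{y - e<..<y + e}.
        h'' x = C * hderiv (hderiv (f j)) x \<and>
        (\<forall>k\<in>{1..K}. elasticity (hderiv (hderiv (f k))) x \<le> elasticity (hderiv (hderiv (f j))) x))"
    if y: "y > 0" "y \<notin> Y" for y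
  proof -
    obtain s where s: "s \<in> insert 0 Y" "s \<ge> 0" "y \<in> piece Y s" using in_some_piece[OF fin y] by auto
    obtain e where e: "e > 0" "{y - e<..<y + e} \<subseteq> piece Y s" using piece_neighbourhood[OF fin s(3)] by auto
    \<comment> \<open>The radius is capped by \<open>y\<close> to stay among the positive
      numbers.\<close>
    define N where "N = {y - min e y<..<y + min e y}"
    have N: "open N" "N \<subseteq> piece Y s" "\<And>x. x \<in> N \<Longrightarrow> x > 0"
      using e by (auto simp: N_def subset_iff min_def split: if_splits)
    have kstar: "kstar K f x = \<kappa> s" if "x \<in> N" for x
      using Y s N that unfolding switching_points_def by blast
    have "y \<in> N" using e \<open>y > 0\<close> by (simp add: N_def)
    then have \<kappa>: "\<kappa> s \<in> {1..K}" using kstar_maximal(1)[OF K, of f y] kstar by simp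
    interpret cost "f (\<kappa> s)" using costs \<kappa> by unfold_locales
    have h': "h' x = C s * hderiv (f (\<kappa> s)) x + q s" if "x \<in> N" for x
    proof (rule hderiv_eq)
      have "(h has_real_derivative C s * hderiv (f (\<kappa> s)) x + q s) (at x)"
      proof (rule has_field_derivative_transform_within_open[OF _ \<open>open N\<close> that])
        show "((\<lambda>y. C s * f (\<kappa> s) y + (p s + q s * y)) has_real_derivative
            C s * hderiv (f (\<kappa> s)) x + q s) (at x)"
          using deriv_at(1)[of x] N(3)[OF that] by (auto intro!: derivative_eq_intros)
      qed (use form(2)[OF s(1)] N in auto)
      then show "(h has_real_derivative C s * hderiv (f (\<kappa> s)) x + q s) (at x within {0..})"
        by (rule has_field_derivative_at_within)
    qed (use N(3)[OF that] in auto)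
    have h'': "h'' x = C s * hderiv (hderiv (f (\<kappa> s))) x" if "x \<in> N" for x
    proof (rule hderiv_eq)
      have "(h' has_real_derivative C s * hderiv (hderiv (f (\<kappa> s))) x) (at x)"
      proof (rule has_field_derivative_transform_within_open[OF _ \<open>open N\<close> that])
        show "((\<lambda>x. C s * hderiv (f (\<kappa> s)) x + q s) has_real_derivative
            C s * hderiv (hderiv (f (\<kappa> s))) x) (at x)"
          using deriv_at(2)[of x] N(3)[OF that] by (auto intro!: derivative_eq_intros)
      qed (use h' in auto)
      then show "(h' has_real_derivative C s * hderiv (hderiv (f (\<kappa> s))) x) (at x within {0..})"
        by (rule has_field_derivative_at_within)
    qed (use N(3)[OF that] in auto)
    have "elasticity (hderiv (hderiv (f k))) x \<le> elasticity (hderiv (hderiv (f (\<kappa> s)))) x"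
      if "x \<in> N" "k \<in> {1..K}" for x k
      using kstar_maximal(2)[OF K that(2), of f x] kstar[OF that(1)] by simp
    then have "\<exists>j\<in>{1..K}. min e y \<le> y \<and> (\<forall>x\<in>{y - min e y<..<y + min e y}.
        h'' x = C s * hderiv (hderiv (f j)) x \<and>
        (\<forall>k\<in>{1..K}. elasticity (hderiv (hderiv (f k))) x \<le> elasticity (hderiv (hderiv (f j))) x))"
      unfolding N_def[symmetric] using \<kappa> h'' by (intro bexI[of _ "\<kappa> s"]) auto
    moreover have "min e y > 0" using e y by simp
    ultimately show ?thesis using form(1)[OF s(1)] by blast
  qed
  then show ?thesis using fin by blast
qed

text \<open>At a switching point \<open>h''\<close> is continuous but need not be differentiable, and its positivity
  there is itself a consequence of the monotonicity of the ratio.\<close>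

lemma ratio_mono:
  assumes k: "k \<in> {1..K}" and "0 < x" "x \<le> y"
  shows "h'' x / hderiv (hderiv (f k)) x \<le> h'' y / hderiv (hderiv (f k)) y"
    and "h'' y > 0"
proof -
  interpret F: cost "f k" using costs k by unfold_locales
  define r where "r x = h'' x / F.f'' x" for x
  obtain Y where fin: "\<And>b. finite (Y \<inter> {..b})"
    and form: "\<And>y. y > 0 \<Longrightarrow> y \<notin> Y \<Longrightarrow> \<exists>C>0. \<exists>e>0. \<exists>j\<in>{1..K}. e \<le> y \<and> (\<forall>x\<in>{y - e<..<y + e}.
        h'' x = C * hderiv (hderiv (f j)) x \<and>
        (\<forall>k\<in>{1..K}. elasticity (hderiv (hderiv (f k))) x \<le> elasticity (hderiv (hderiv (f j))) x))"
    using envelope_local_form by blast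
  have r: "r a \<le> r b" if "0 < a" "a \<le> b" for a b
  proof (rule nondecreasing_except_finite[OF fin[of b] \<open>a \<le> b\<close>])
    show "continuous_on {a..b} r"
      unfolding r_def using \<open>0 < a\<close> F.deriv2_pos
      by (intro continuous_intros continuous_on_subset[OF envelope_smooth(3)]
          continuous_on_subset[OF F.continuous(3)]) (auto simp: less_imp_neq[symmetric] order.strict_trans2)
    fix x assume "x \<in> {a..b} - Y \<inter> {..b}"
    then have "x > 0" "x \<notin> Y" using \<open>0 < a\<close> by auto
    from form[OF this] obtain C e j where C: "C > 0" "e > 0" "e \<le> x" "j \<in> {1..K}"
      and loc: "\<And>z. z \<in> {x - e<..<x + e} \<Longrightarrow> h'' z = C * hderiv (hderiv (f j)) z"
        "elasticity F.f'' x \<le> elasticity (hderiv (hderiv (f j))) x"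
      using k by fastforce
    interpret J: cost "f j" using costs C by unfold_locales
    have pos: "F.f'' x > 0" "J.f'' x > 0" using F.deriv2_pos J.deriv2_pos \<open>x > 0\<close> by auto
    \<comment> \<open>The quotient rule; the sign of \<open>D\<close> is that of the elasticity of
      \<open>J.f''\<close> minus that of \<open>F.f''\<close>.\<close>
    define D where "D = C * ((J.f''' x * F.f'' x - J.f'' x * F.f''' x) / (F.f'' x * F.f'' x))"
    have "(r has_real_derivative D) (at x)"
    proof (rule has_field_derivative_transform_within_open[where S = "{x - e<..<x + e}"])
      show "((\<lambda>z. C * (J.f'' z / F.f'' z)) has_real_derivative D) (at x)"
        unfolding D_def using pos
        by (intro DERIV_cmult DERIV_divide J.deriv_at F.deriv_at \<open>x > 0\<close>) auto
    qed (use C loc(1) in \<open>auto simp: r_def\<close>)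
    moreover have "x * F.f''' x / F.f'' x \<le> x * J.f''' x / J.f'' x"
      using loc(2) by (simp add: elasticity_def)
    then have "J.f'' x * F.f''' x \<le> J.f''' x * F.f'' x"
      using pos \<open>x > 0\<close> by (simp add: field_simps)
    then have "D \<ge> 0" using pos C by (simp add: D_def)
    ultimately show "\<exists>d\<ge>0. (r has_real_derivative d) (at x)" by blast
  qed
  show "h'' x / F.f'' x \<le> h'' y / F.f'' y" using r[of x y] assms by (simp add: r_def)
  \<comment> \<open>At a point \<open>a\<close> below \<open>y\<close> off the switching points the
    local form gives h'' a > 0, and the monotone ratio carries positivity up to
    \<open>y\<close>.\<close>
  have "infinite {0<..<y}" using assms by (simp add: infinite_Ioo)
  then obtain a where a: "a \<in> {0<..<y}" "a \<notin> Y"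
    using finite_subset[OF _ fin[of y], of "{0<..<y}"] by fastforce
  then obtain C j where C: "C > 0" "j \<in> {1..K}" "h'' a = C * hderiv (hderiv (f j)) a"
    using form[of a] by (smt (verit, best) greaterThanLessThan_iff)
  interpret J: cost "f j" using costs C(2) by unfold_locales
  have "r a > 0" using C J.deriv2_pos[of a] F.deriv2_pos[of a] a by (simp add: r_def)
  then have "r y > 0" using r[of a y] a by simp
  then show "h'' y > 0" using F.deriv2_pos[of y] assms by (simp add: r_def zero_less_divide_iff)
qed

text \<open>Comparing the ratio h'' / f'' at x <= z with its value at \<open>z\<close> shows that
  h''(z) f' - f''(z) h' is nondecreasing on [y, z], which is the claim after clearing
  denominators.\<close>

lemma slope_comparison:
  assumes k: "k \<in> {1..K}" and "0 < y" "y \<le> z"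
  shows "(h' z - h' y) / h'' z \<le> (hderiv (f k) z - hderiv (f k) y) / hderiv (hderiv (f k)) z"
proof -
  interpret F: cost "f k" using costs k by unfold_locales
  have pos: "h'' z > 0" "F.f'' z > 0" using ratio_mono(2)[OF k, of z] F.deriv2_pos assms by auto
  have "h'' z * F.f' y - F.f'' z * h' y \<le> h'' z * F.f' z - F.f'' z * h' z"
  proof (rule DERIV_nonneg_imp_nondecreasing[OF \<open>y \<le> z\<close>])
    fix x assume "y \<le> x" "x \<le> z"
    then have "x > 0" using assms by simp
    have "F.f'' x > 0" using F.deriv2_pos \<open>x > 0\<close> .
    have "F.f'' z * h'' x \<le> h'' z * F.f'' x"
      using ratio_mono(1)[OF k \<open>x > 0\<close> \<open>x \<le> z\<close>] \<open>F.f'' x > 0\<close> pos by (simp add: field_simps)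
    then show "\<exists>d. ((\<lambda>x. h'' z * F.f' x - F.f'' z * h' x) has_real_derivative d) (at x) \<and> d \<ge> 0"
      using F.deriv_at(2)[OF \<open>x > 0\<close>] envelope_deriv2_at[OF \<open>x > 0\<close>]
      by (intro exI[of _ "h'' z * F.f'' x - F.f'' z * h'' x"]) (auto intro!: derivative_eq_intros)
  qed
  then show ?thesis using pos by (simp add: field_simps)
qed

end

section \<open>The universal design space\<close>

theorem theorem3:
  fixes \<sigma> \<tau> \<alpha> :: real and m K :: nat
    and f :: "nat \<Rightarrow> real \<Rightarrow> real" and fhat :: "real \<Rightarrow> real"
  assumes "m \<ge> 1" and "K \<ge> 1"
    and "\<tau> \<ge> 1" and "\<sigma> \<ge> \<tau>" and "\<sigma> > 1"
    and "\<And>k. k \<in> {1..K} \<Longrightarrow> strongly_elastic \<tau> \<sigma> (f k)"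
    and "safe_envelope K f fhat"
    and "\<alpha> \<ge> \<sigma> powr (\<sigma> / (\<sigma> - 1))"
  shows "universal_design_space m \<alpha> (design_space \<alpha> fhat) (f ` {1..K})"
proof -
  interpret envelope K f fhat
    using assms by unfold_locales (auto simp: strongly_elastic_def)
  have "1 \<le> \<sigma> powr (\<sigma> / (\<sigma> - 1))" using \<open>\<sigma> > 1\<close> by (intro ge_one_powr_ge_zero) auto
  then have "\<alpha> \<ge> 1" using assms(8) by simp
  have reserve: "reserve (f k) \<phi> (deriv \<phi>) \<alpha>"
    if k: "k \<in> {1..K}" and \<phi>: "\<phi> \<in> design_space \<alpha> fhat" for k \<phi>
  proof -
    interpret cost "f k" using costs[OF k] by unfold_locales
    have ode: "deriv \<phi> y = \<alpha> * ((h' (\<phi> y) - h' y) / (\<phi> y * h'' (\<phi> y)))" and ge: "\<phi> y \<ge> y"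
      if "y > 0" for y
      using \<phi> that by (auto simp: design_space_def)
    show ?thesis
    proof unfold_locales
      fix y :: real assume "y > 0"
      then have "\<phi> differentiable (at y)" using \<phi> by (simp add: design_space_def)
      then show "(\<phi> has_real_derivative deriv \<phi> y) (at y)"
        by (rule DERIV_deriv_iff_real_differentiable[THEN iffD2])
      have pos: "\<phi> y > 0" "f'' (\<phi> y) > 0" using ge[OF \<open>y > 0\<close>] \<open>y > 0\<close> deriv2_pos[of "\<phi> y"] by auto
      \<comment> \<open>Multiplied by \<phi> y, the equation of the envelope contains exactly the
        quotient that \<open>slope_comparison\<close> bounds.\<close>
      have "\<phi> y * deriv \<phi> y = \<alpha> * ((h' (\<phi> y) - h' y) / h'' (\<phi> y))"
        using ode[OF \<open>y > 0\<close>] pos by simp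
      also have "\<dots> \<le> \<alpha> * ((f' (\<phi> y) - f' y) / f'' (\<phi> y))"
        using slope_comparison[OF k \<open>y > 0\<close> ge[OF \<open>y > 0\<close>]] \<open>\<alpha> \<ge> 1\<close>
        by (intro mult_left_mono) auto
      finally show "\<phi> y * f'' (\<phi> y) * deriv \<phi> y \<le> \<alpha> * (f' (\<phi> y) - f' y)"
        using pos by (simp add: field_simps)
    qed (use \<phi> \<open>\<alpha> \<ge> 1\<close> in \<open>auto simp: design_space_def\<close>)
  qed
  show ?thesis
    unfolding universal_design_space_def
  proof (intro ballI conjI subsetI)
    fix g assume "g \<in> f ` {1..K}"
    then obtain k where k: "k \<in> {1..K}" "g = f k" by auto
    show "reserve_competitive m g \<alpha> \<phi>" if "\<phi> \<in> design_space \<alpha> fhat" for \<phi>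
      using reserve.reserve_competitive[OF reserve[OF k(1) that]] k(2) by simp
    fix z assume "z \<in> planar_region (design_space \<alpha> fhat)"
    then obtain \<phi> y where \<phi>: "\<phi> \<in> design_space \<alpha> fhat" and z: "z = (y, \<phi> y)" "y \<ge> 0"
      by (auto simp: planar_region_def)
    have "\<exists>\<psi>\<in>design_space \<alpha> g. \<psi> y = \<phi> y"
    proof (cases "y = 0")
      case True
      \<comment> \<open>All reserve functions vanish at 0, so any member will do; the abscissa 1 is
        an arbitrary positive choice.\<close>
      obtain \<psi> where "\<psi> \<in> design_space \<alpha> g"
        using reserve.design_space_through[OF reserve[OF k(1) \<phi>], of 1] k(2) by auto
      then show ?thesis using \<phi> True by (intro bexI[of _ \<psi>]) (auto simp: design_space_def)
    next
      case False
      then show ?thesis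
        using reserve.design_space_through[OF reserve[OF k(1) \<phi>], of y] k(2) z by auto
    qed
    then obtain \<psi> where "\<psi> \<in> design_space \<alpha> g" "z = (y, \<psi> y)" using z by auto
    then show "z \<in> planar_region (design_space \<alpha> g)" using z by (auto simp: planar_region_def)
  qed
qed

end
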